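(* Let $\widetilde{H}$ be the affine Hecke algebra of type $G_2$ and assume $q^2\neq\pm1$. Let $t=t_{1,q^2}$ and $w_0=s_1s_2s_1s_2s_1s_2$. Let $\mathbb{C}v_t$ and $\mathbb{C}v_{w_0t}$ be the $1$-dimensional $\widetilde{H}_{\{2\}}$-modules given by $T_2v_t=qv_t$, $X^\lambda v_t=t(X^\lambda)v_t$, and $T_2v_{w_0t}=-q^{-1}v_{w_0t}$, $X^\lambda v_{w_0t}=(w_0t)(X^\lambda)v_{w_0t}$, and let $M=\widetilde{H}\otimes_{\widetilde{H}_{\{2\}}}\mathbb{C}v_t$ and $N=\widetilde{H}\otimes_{\widetilde{H}_{\{2\}}}\mathbb{C}v_{w_0t}$. (a) $M_{s_1s_2s_1s_2t}$ is a $1$-dimensional submodule of $M$. Let $M'$ be the image of the weight spaces $M_{s_2s_1s_2t}$ and $M_{s_1s_2t}$ (i.e. of their sum) in $M/M_{s_1s_2s_1s_2t}$. Then $M'$ is a submodule of $M/M_{s_1s_2s_1s_2t}$, and the resulting quotient of $M$ is irreducible. (b) If $q^2$ is not a primitive third root of unity, then $M'$ is irreducible. (c) If $q^2$ is a primitive third root of unity, then $(M')_{s_2s_1s_2t}$ is a submodule of $M'$. (d) $N_{s_2t}$ is a $1$-dimensional submodule of $N$. Let $N'$ be the image of the weight spaces $N_{s_1s_2t}$ and $N_{s_2s_1s_2t}$ in $N/N_{s_2t}$. Then $N'$ is a submodule of $N/N_{s_2t}$, and the resulting quotient of $N$ is irreducible. (e) If $q^2$ is not a primitive third root of unity, then $N'$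 is irreducible. (f) If $q^2$ is a primitive third root of unity, then $(N')_{s_1s_2t}$ is a submodule of $N'$.
   Context: The type $G_2$ root system has simple roots $\alpha_1,\alpha_2$ with $\langle\alpha_1,\alpha_2^\vee\rangle=-1$, $\langle\alpha_2,\alpha_1^\vee\rangle=-3$; $s_i\lambda=\lambda-\langle\lambda,\alpha_i^\vee\rangle\alpha_i$, and $W_0=\langle s_1,s_2\rangle$. $P=\mathbb{Z}\alpha_1+\mathbb{Z}\alpha_2$ is the weight lattice; $X=\{X^\lambda\mid\lambda\in P\}$, $X^\lambda X^\mu=X^{\lambda+\mu}$. For $q\in\mathbb{C}^\times$, $\widetilde{H}$ is the $\mathbb{C}$-algebra generated by $T_1,T_2$ and $X^\lambda$ ($\lambda\in P$), with the group algebra $\mathbb{C}[X]$ a subalgebra, subject to $T_i^2=(q-q^{-1})T_i+1$, $T_1T_2T_1T_2T_1T_2=T_2T_1T_2T_1T_2T_1$, and $X^\lambda T_i=T_iX^{s_i\lambda}+(q-q^{-1})\frac{X^\lambda-X^{s_i\lambda}}{1-X^{-\alpha_i}}$. $\widetilde{H}_{\{i\}}$ is the subalgebra generated by $T_i$ and $\mathbb{C}[X]$. Weights are elements of $T=\mathrm{Hom}(X,\mathbb{C}^\times)$, with $W_0$-action $(wt)(X^\lambda)=t(X^{w^{-1}\lambda})$; $t_{z,w}\in T$ is given by $t_{z,w}(X^{\alpha_1})=z$, $t_{z,w}(X^{\alpha_2})=w$. For a finite-dimensional $\widetilde{H}$-module $M$, $M_t=\{m\mid X^\lambda m=t(X^\lambda)m\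 \forall\lambda\in P\}$. *)

theory Defs
  imports
    Complex_Main
    "HOL-Library.Product_Plus"
    "HOL-Library.Poly_Mapping"
    "HOL-Algebra.Module"
    "HOL-Algebra.QuotRing"
    "HOL-Algebra.Generated_Rings"
    "HOL-Algebra.Free_Abelian_Groups"
begin

section \<open>The root system and the weights\<close>

datatype node = Node1 | Node2

text \<open>The pair \<open>(a, b)\<close> stands for \<open>a \<alpha>\<^sub>1 + b \<alpha>\<^sub>2\<close> in the lattice \<open>P\<close>.\<close>

type_synonym lattice = "int \<times> int"

fun simple_root :: "node \<Rightarrow> lattice" where
  "simple_root Node1 = (1, 0)"
| "simple_root Node2 = (0, 1)"

text \<open>\<open>cartan i j\<close> is the pairing of \<open>\<alpha>\<^sub>i\<close> with the coroot of \<open>\<alpha>\<^sub>j\<close>.\<close>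

fun cartan :: "node \<Rightarrow> node \<Rightarrow> int" where
  "cartan Node1 Node1 = 2"
| "cartan Node1 Node2 = -1"
| "cartan Node2 Node1 = -3"
| "cartan Node2 Node2 = 2"

definition pairing :: "lattice \<Rightarrow> node \<Rightarrow> int" where
  "pairing l i = fst l * cartan Node1 i + snd l * cartan Node2 i"

definition reflection :: "node \<Rightarrow> lattice \<Rightarrow> lattice" where
  "reflection i l = l - (pairing l i * fst (simple_root i), pairing l i * snd (simple_root i))"

abbreviation s1 :: "lattice \<Rightarrow> lattice" where "s1 \<equiv> reflection Node1"
abbreviation s2 :: "lattice \<Rightarrow> lattice" where "s2 \<equiv> reflection Node2"

text \<open>
  A weight \<open>t\<close> in \<open>Hom(X, \<complex>\<^sup>\<times>)\<close> is represented by the function sending \<open>\<lambda>\<close> to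
  \<open>t(X\<^sup>\<lambda>)\<close>. For nonzero \<open>z\<close> and \<open>w\<close>, \<open>weight_at z w\<close> is the unique homomorphism with values
  \<open>z\<close> at \<open>\<alpha>\<^sub>1\<close> and \<open>w\<close> at \<open>\<alpha>\<^sub>2\<close>.
\<close>

definition weight_at :: "complex \<Rightarrow> complex \<Rightarrow> lattice \<Rightarrow> complex" where
  "weight_at z w l = z powi fst l * w powi snd l"

definition weight_act :: "(lattice \<Rightarrow> lattice) \<Rightarrow> (lattice \<Rightarrow> complex) \<Rightarrow> lattice \<Rightarrow> complex" where
  "weight_act u t l = t (inv_into UNIV u l)"

definition primitive_root_of_unity :: "nat \<Rightarrow> complex \<Rightarrow> bool" where
  "primitive_root_of_unity n z \<longleftrightarrow> 0 < n \<and> z ^ n = 1 \<and> (\<forall>k. 0 < k \<and> k < n \<longrightarrow> z ^ k \<noteq> 1)"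


section \<open>The affine Hecke algebra\<close>

datatype gen = T node | X lattice

text \<open>
  The free monoid on the generators, written additively so that \<open>word \<Rightarrow>\<^sub>0 complex\<close>, with the
  convolution product, is the free unital \<open>\<complex>\<close>-algebra on them.
\<close>

datatype word = Word (letters: "gen list")

instantiation word :: monoid_add
begin

definition zero_word :: word where
  "zero_word = Word []"

definition plus_word :: "word \<Rightarrow> word \<Rightarrow> word" where
  "plus_word u v = Word (letters u @ letters v)"

instance
  by intro_classes (simp_all add: zero_word_def plus_word_def)

end

type_synonym free_algebra = "word \<Rightarrow>\<^sub>0 complex"

definition fscal :: "complex \<Rightarrow> free_algebra" where
  "fscal c = Poly_Mapping.single 0 c"

definition fT :: "node \<Rightarrow> free_algebra" where
  "fT i = Poly_Mapping.single (Word [T i]) 1"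

definition fX :: "lattice \<Rightarrow> free_algebra" where
  "fX l = Poly_Mapping.single (Word [X l]) 1"

text \<open>
  The group algebra \<open>\<complex>[X]\<close> is \<open>lattice \<Rightarrow>\<^sub>0 complex\<close>; \<open>fXlin\<close> is the linear map from it to the
  free algebra that sends each basis vector \<open>X\<^sup>\<lambda>\<close> to the corresponding generator.
\<close>

definition fXlin :: "(lattice \<Rightarrow>\<^sub>0 complex) \<Rightarrow> free_algebra" where
  "fXlin f = (\<Sum>l\<in>Poly_Mapping.keys f. fscal (Poly_Mapping.lookup f l) * fX l)"

text \<open>
  In the rule \<open>bernstein\<close>, \<open>f\<close> is the element of \<open>\<complex>[X]\<close> denoted by the fraction
  \<open>(X\<^sup>\<lambda> - X\<^bsup>s\<^sub>i\<lambda>\<^esup>) / (1 - X\<^bsup>-\<alpha>\<^sub>i\<^esup>)\<close>; it exists, and it is unique because \<open>\<complex>[X]\<close> is a domain.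
\<close>

inductive_set hecke_relations :: "complex \<Rightarrow> free_algebra set" for q :: complex where
  X_zero: "fX 0 - 1 \<in> hecke_relations q"
| X_add: "fX l * fX m - fX (l + m) \<in> hecke_relations q"
| quadratic: "fT i ^ 2 - (fscal (q - inverse q) * fT i + 1) \<in> hecke_relations q"
| braid: "fT Node1 * fT Node2 * fT Node1 * fT Node2 * fT Node1 * fT Node2
        - fT Node2 * fT Node1 * fT Node2 * fT Node1 * fT Node2 * fT Node1 \<in> hecke_relations q"
| bernstein:
    "f * (1 - Poly_Mapping.single (- simple_root i) 1)
       = Poly_Mapping.single l 1 - Poly_Mapping.single (reflection i l) 1
     \<Longrightarrow> fX l * fT i - (fT i * fX (reflection i l) + fscal (q - inverse q) * fXlin f)
          \<in> hecke_relations q"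

definition free_ring :: "free_algebra ring" where
  "free_ring = \<lparr>carrier = UNIV, mult = (*), one = 1, ring.zero = 0, add = (+)\<rparr>"

definition hecke_ideal :: "complex \<Rightarrow> free_algebra set" where
  "hecke_ideal q = Idl\<^bsub>free_ring\<^esub> (hecke_relations q)"

definition hecke :: "complex \<Rightarrow> free_algebra set ring" where
  "hecke q = free_ring Quot hecke_ideal q"

definition hscal :: "complex \<Rightarrow> complex \<Rightarrow> free_algebra set" where
  "hscal q c = hecke_ideal q +>\<^bsub>free_ring\<^esub> fscal c"

definition hT :: "complex \<Rightarrow> node \<Rightarrow> free_algebra set" where
  "hT q i = hecke_ideal q +>\<^bsub>free_ring\<^esub> fT i"

definition hX :: "complex \<Rightarrow> lattice \<Rightarrow> free_algebra set" where
  "hX q l = hecke_ideal q +>\<^bsub>free_ring\<^esub> fX l"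

definition parabolic :: "complex \<Rightarrow> node \<Rightarrow> free_algebra set ring" where
  "parabolic q i =
     (hecke q)\<lparr>carrier := generate_ring (hecke q) (range (hscal q) \<union> {hT q i} \<union> range (hX q))\<rparr>"


section \<open>Left modules over a possibly noncommutative ring\<close>

text \<open>
  The records and \<^locale>\<open>submodule\<close> of HOL-Algebra are reused; its locale \<^locale>\<open>module\<close> cannot be,
  since it requires a commutative ring. The ring fields \<open>mult\<close> and \<open>one\<close> of a module record
  carry no information and are left undefined below.
\<close>

locale left_module = R?: ring R + M?: abelian_group M
  for R :: "('a, 'r) ring_scheme" (structure) and M :: "('a, 'b, 'm) module_scheme" (structure) +
  assumes smult_closed:
      "\<lbrakk> a \<in> carrier R; x \<in> carrier M \<rbrakk> \<Longrightarrow> a \<odot>\<^bsub>M\<^esub> x \<in> carrier M"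
    and smult_l_distr:
      "\<lbrakk> a \<in> carrier R; b \<in> carrier R; x \<in> carrier M \<rbrakk> \<Longrightarrow>
         (a \<oplus>\<^bsub>R\<^esub> b) \<odot>\<^bsub>M\<^esub> x = a \<odot>\<^bsub>M\<^esub> x \<oplus>\<^bsub>M\<^esub> b \<odot>\<^bsub>M\<^esub> x"
    and smult_r_distr:
      "\<lbrakk> a \<in> carrier R; x \<in> carrier M; y \<in> carrier M \<rbrakk> \<Longrightarrow>
         a \<odot>\<^bsub>M\<^esub> (x \<oplus>\<^bsub>M\<^esub> y) = a \<odot>\<^bsub>M\<^esub> x \<oplus>\<^bsub>M\<^esub> a \<odot>\<^bsub>M\<^esub> y"
    and smult_assoc:
      "\<lbrakk> a \<in> carrier R; b \<in> carrier R; x \<in> carrier M \<rbrakk> \<Longrightarrow>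
         (a \<otimes>\<^bsub>R\<^esub> b) \<odot>\<^bsub>M\<^esub> x = a \<odot>\<^bsub>M\<^esub> (b \<odot>\<^bsub>M\<^esub> x)"
    and smult_one:
      "x \<in> carrier M \<Longrightarrow> \<one>\<^bsub>R\<^esub> \<odot>\<^bsub>M\<^esub> x = x"

locale irreducible_module = left_module +
  assumes nonzero: "carrier M \<noteq> {\<zero>\<^bsub>M\<^esub>}"
    and no_proper: "submodule U R M \<Longrightarrow> U = {\<zero>\<^bsub>M\<^esub>} \<or> U = carrier M"

definition quotient_module :: "('a, 'b) module \<Rightarrow> 'b set \<Rightarrow> ('a, 'b set) module" where
  "quotient_module M U =
     \<lparr>carrier = a_rcosets\<^bsub>M\<^esub> U, mult = undefined, one = undefined, ring.zero = U, add = set_add M,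
      smult = (\<lambda>r C. \<Union>x\<in>C. U +>\<^bsub>M\<^esub> (r \<odot>\<^bsub>M\<^esub> x))\<rparr>"

text \<open>
  The tensor product \<open>R \<otimes>\<^sub>S L\<close> of a ring \<open>R\<close>, as a right module over a subring \<open>S\<close>, with a left
  \<open>S\<close>-module \<open>L\<close>: the free abelian group on \<open>R \<times> L\<close> modulo the subgroup generated by the
  relations that make the pairing biadditive and \<open>S\<close>-balanced, with \<open>R\<close> acting by left
  multiplication on the first factor.
\<close>

inductive_set tensor_relations :: "'a ring \<Rightarrow> 'a ring \<Rightarrow> ('a, 'b) module \<Rightarrow> ('a \<times> 'b \<Rightarrow>\<^sub>0 int) set"
  for R S L where
  add_left: "\<lbrakk> a \<in> carrier R; b \<in> carrier R; x \<in> carrier L \<rbrakk> \<Longrightarrow>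
    frag_of (a \<oplus>\<^bsub>R\<^esub> b, x) - (frag_of (a, x) + frag_of (b, x)) \<in> tensor_relations R S L"
| add_right: "\<lbrakk> a \<in> carrier R; x \<in> carrier L; y \<in> carrier L \<rbrakk> \<Longrightarrow>
    frag_of (a, x \<oplus>\<^bsub>L\<^esub> y) - (frag_of (a, x) + frag_of (a, y)) \<in> tensor_relations R S L"
| balanced: "\<lbrakk> a \<in> carrier R; s \<in> carrier S; x \<in> carrier L \<rbrakk> \<Longrightarrow>
    frag_of (a \<otimes>\<^bsub>R\<^esub> s, x) - frag_of (a, s \<odot>\<^bsub>L\<^esub> x) \<in> tensor_relations R S L"

definition induced_module ::
  "'a ring \<Rightarrow> 'a ring \<Rightarrow> ('a, 'b) module \<Rightarrow> ('a, ('a \<times> 'b \<Rightarrow>\<^sub>0 int) set) module" where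
  "induced_module R S L =
    (let F = free_Abelian_group (carrier R \<times> carrier L);
         K = generate F (tensor_relations R S L)
     in \<lparr>carrier = carrier (F Mod K), mult = undefined, one = undefined,
         ring.zero = \<one>\<^bsub>F Mod K\<^esub>, add = monoid.mult (F Mod K),
         smult = (\<lambda>r C. \<Union>c\<in>C. K #>\<^bsub>F\<^esub> frag_extend (\<lambda>(a, x). frag_of (r \<otimes>\<^bsub>R\<^esub> a, x)) c)\<rparr>)"


section \<open>Modules over the affine Hecke algebra\<close>

definition weight_space ::
  "complex \<Rightarrow> (free_algebra set, 'b) module \<Rightarrow> (lattice \<Rightarrow> complex) \<Rightarrow> 'b set" where
  "weight_space q M t = {m \<in> carrier M. \<forall>l. hX q l \<odot>\<^bsub>M\<^esub> m = hscal q (t l) \<odot>\<^bsub>M\<^esub> m}"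

text \<open>Modules are complex vector spaces through the scalars \<open>hscal q c\<close> of the algebra.\<close>

definition complex_line ::
  "complex \<Rightarrow> (free_algebra set, 'b) module \<Rightarrow> 'b \<Rightarrow> 'b set" where
  "complex_line q M v = range (\<lambda>c. hscal q c \<odot>\<^bsub>M\<^esub> v)"

definition one_dimensional ::
  "complex \<Rightarrow> (free_algebra set, 'b) module \<Rightarrow> 'b set \<Rightarrow> bool" where
  "one_dimensional q M U \<longleftrightarrow>
     U \<subseteq> carrier M \<and> (\<exists>v\<in>U. v \<noteq> \<zero>\<^bsub>M\<^esub> \<and> U = complex_line q M v)"

text \<open>
  \<open>L\<close> is the one-dimensional module \<open>\<complex>v\<close> over the subalgebra generated by \<open>T\<^sub>i\<close> and \<open>\<complex>[X]\<close>, with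
  \<open>T\<^sub>i v = c v\<close> and \<open>X\<^sup>\<lambda> v = t(X\<^sup>\<lambda>) v\<close>.
\<close>

definition line_module ::
  "complex \<Rightarrow> node \<Rightarrow> complex \<Rightarrow> (lattice \<Rightarrow> complex) \<Rightarrow> (free_algebra set, 'b) module \<Rightarrow> 'b \<Rightarrow> bool"
  where
  "line_module q i c t L v \<longleftrightarrow>
     left_module (parabolic q i) L \<and>
     v \<in> carrier L \<and> v \<noteq> \<zero>\<^bsub>L\<^esub> \<and> carrier L = complex_line q L v \<and>
     hT q i \<odot>\<^bsub>L\<^esub> v = hscal q c \<odot>\<^bsub>L\<^esub> v \<and>
     (\<forall>l. hX q l \<odot>\<^bsub>L\<^esub> v = hscal q (t l) \<odot>\<^bsub>L\<^esub> v)"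

end

theory Submission
  imports Defs
begin

text \<open>
  Write \<open>t = t\<^bsub>1,q\<^sup>2\<^esub>\<close>. As \<open>s\<^sub>1\<close> fixes \<open>t\<close>, the six elements \<open>T\<^sub>w \<otimes> v\<^sub>t\<close>, for the minimal coset
  representatives \<open>w\<close> of \<open>W\<^sub>0 / \<langle>s\<^sub>2\<rangle>\<close>, span a module \<open>M\<close> whose generalized weights are \<open>t\<close> (twice),
  \<open>s\<^sub>2t\<close>, \<open>s\<^sub>1s\<^sub>2t\<close>, \<open>s\<^sub>2s\<^sub>1s\<^sub>2t\<close> and \<open>s\<^sub>1s\<^sub>2s\<^sub>1s\<^sub>2t\<close>. Away from \<open>q\<^sup>2 = \<plusminus>1\<close> these five weights are distinct.
  If \<open>\<tau>(X\<^bsup>\<alpha>\<^sub>i\<^esup>) = x \<noteq> 1\<close> and the weights \<open>\<tau>\<close> and \<open>s\<^sub>i\<tau>\<close> both have multiplicity one, then \<open>T\<^sub>i\<close> acts on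
  the sum of the two weight spaces by a \<open>2 \<times> 2\<close> matrix whose diagonal is determined by \<open>x\<close>, and the
  quadratic relation then fixes the product of the two remaining entries. It vanishes exactly for
  \<open>x = q\<^bsup>\<plusminus>2\<^esup>\<close>. This happens twice along the chain of weights, for \<open>T\<^sub>1\<close> between \<open>s\<^sub>2t\<close> and \<open>s\<^sub>1s\<^sub>2t\<close>
  and for \<open>T\<^sub>1\<close> between \<open>s\<^sub>2s\<^sub>1s\<^sub>2t\<close> and \<open>s\<^sub>1s\<^sub>2s\<^sub>1s\<^sub>2t\<close>; cutting the chain there gives the three layers of
  dimensions 3, 2 and 1. Within the middle layer \<open>x = q\<^bsup>\<plusminus>4\<^esup>\<close>, and the product is
  \<open>(q\<^sup>4 + q\<^sup>2 + 1) / (q\<^sup>2 + 1)\<^sup>2\<close>, so that this layer has a proper nonzero submodule exactly when \<open>q\<^sup>2\<close> is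
  a primitive third root of unity.

  To make this rigorous, the expected action is written down on \<open>\<complex>\<^sup>6\<close> in a basis adapted to the
  weights (\<open>opT\<close>, \<open>opX\<close>), and the defining relations are verified there
  (\<open>act_hecke_relations\<close>). The universal property of the tensor product then maps \<open>M\<close> onto this
  model. In the other direction, the relations of the algebra alone show that the six elements
  \<open>T\<^sub>w \<otimes> v\<^sub>t\<close> span \<open>M\<close>; since their images in the model are linearly independent, the map is
  injective (\<open>act_zero_imp_J\<close>, \<open>coordinatised_induced_module\<close>). All assertions about \<open>M\<close> and its
  quotients thereby become assertions about invariant subspaces of \<open>\<complex>\<^sup>6\<close>, which are short
  calculations (\<open>tail3_maximal\<close>, \<open>tail1_maximal\<close>, \<open>submodule_structure\<close>).

  Nothing new has to be done for \<open>N\<close>. The relations involve \<open>q\<close> only through \<open>q - q\<^sup>-\<^sup>1\<close>, which is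
  unchanged under \<open>q \<mapsto> - q\<^sup>-\<^sup>1\<close>, so the algebra is literally the same for both parameters. As
  \<open>w\<^sub>0t = t\<^bsub>1,q\<^sup>-\<^sup>2\<^esub>\<close>, the module \<open>N\<close> for \<open>q\<close> is the module \<open>M\<close> for \<open>- q\<^sup>-\<^sup>1\<close>.
\<close>

section \<open>Representations of monoid algebras\<close>

lemma single_sum_expansion:
  fixes f :: "'m \<Rightarrow>\<^sub>0 'a :: comm_monoid_add"
  shows "f = (\<Sum>m\<in>Poly_Mapping.keys f. Poly_Mapping.single m (Poly_Mapping.lookup f m))"
  by (rule poly_mapping_eqI)
    (auto simp: lookup_sum lookup_single when_def sum.delta in_keys_iff)

lemma poly_mapping_single_plus_induct [case_names single plus]:
  fixes f :: "'m \<Rightarrow>\<^sub>0 'a :: comm_monoid_add"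
  assumes single: "\<And>m c. P (Poly_Mapping.single m c)"
    and plus: "\<And>f g. P f \<Longrightarrow> P g \<Longrightarrow> P (f + g)"
  shows "P f"
proof -
  have "P (\<Sum>m\<in>S. Poly_Mapping.single m (Poly_Mapping.lookup f m))" for S
    by (induction S rule: infinite_finite_induct)
      (use single[of undefined 0] in \<open>auto intro: single plus\<close>)
  then show ?thesis by (subst single_sum_expansion)
qed

text \<open>
  Two monoids act on the model: words in the generators and the lattice. One construction extends
  both actions, to the free algebra and to the group algebra.
\<close>

locale monoid_rep = vector_space scale
  for scale :: "complex \<Rightarrow> 'v :: ab_group_add \<Rightarrow> 'v" +
  fixes op :: "'m :: monoid_add \<Rightarrow> 'v \<Rightarrow> 'v"
  assumes op_zero: "op 0 x = x"
    and op_plus: "op (a + b) x = op a (op b x)"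
    and op_add: "op a (x + y) = op a x + op a y"
    and op_scale: "op a (scale c x) = scale c (op a x)"
begin

definition act :: "('m \<Rightarrow>\<^sub>0 complex) \<Rightarrow> 'v \<Rightarrow> 'v" where
  "act f x = (\<Sum>m\<in>Poly_Mapping.keys f. scale (Poly_Mapping.lookup f m) (op m x))"

lemma act_superset:
  assumes "finite S" "Poly_Mapping.keys f \<subseteq> S"
  shows "act f x = (\<Sum>m\<in>S. scale (Poly_Mapping.lookup f m) (op m x))"
  unfolding act_def
  by (rule sum.mono_neutral_left) (use assms in \<open>auto simp: in_keys_iff\<close>)

lemma act_single [simp]: "act (Poly_Mapping.single m c) x = scale c (op m x)"
  by (subst act_superset[of "{m}"]) auto

lemma act_zero [simp]: "act 0 x = 0"
  by (simp add: act_def)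

lemma act_one [simp]: "act 1 x = x"
  using act_single[of 0 1 x] by (simp add: op_zero)

lemma act_plus: "act (f + g) x = act f x + act g x"
proof -
  let ?S = "Poly_Mapping.keys f \<union> Poly_Mapping.keys g"
  have "act (f + g) x = (\<Sum>m\<in>?S. scale (Poly_Mapping.lookup (f + g) m) (op m x))"
    by (rule act_superset) (use Poly_Mapping.keys_add[of f g] in auto)
  also have "\<dots> = (\<Sum>m\<in>?S. scale (Poly_Mapping.lookup f m) (op m x))
      + (\<Sum>m\<in>?S. scale (Poly_Mapping.lookup g m) (op m x))"
    by (simp add: lookup_add scale_left_distrib sum.distrib)
  finally show ?thesis
    by (simp add: act_superset[of ?S])
qed

lemma act_uminus: "act (- f) x = - act f x"
  using act_plus[of f "- f" x] by (simp add: minus_unique)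

lemma act_diff: "act (f - g) x = act f x - act g x"
  using act_plus[of f "- g" x] by (simp add: act_uminus)

lemma act_sum: "act (\<Sum>i\<in>S. f i) x = (\<Sum>i\<in>S. act (f i) x)"
  by (induction S rule: infinite_finite_induct) (auto simp: act_plus)

lemma act_add_right: "act f (x + y) = act f x + act f y"
  by (simp add: act_def op_add scale_right_distrib sum.distrib)

lemma act_scale_right: "act f (scale c x) = scale c (act f x)"
  by (simp add: act_def op_scale scale_sum_right mult.commute)

lemma act_zero_right: "act f 0 = 0"
  using act_scale_right[of f 0 0] by simp

lemma act_mult: "act (f * g) x = act f (act g x)"
proof (induction f rule: poly_mapping_single_plus_induct)
  case (single m c)
  show ?case
  proof (induction g rule: poly_mapping_single_plus_induct)
    case (single n d)
    then show ?case by (simp add: mult_single op_plus op_scale)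
  next
    case (plus f g)
    then show ?case by (simp add: distrib_left act_plus act_add_right)
  qed
next
  case (plus f g)
  then show ?case by (simp add: distrib_right act_plus)
qed

end

section \<open>Divided differences\<close>

text \<open>
  \<open>divided_difference i l f\<close> says that \<open>f\<close> is the fraction \<open>(X\<^sup>l - X\<^bsup>s\<^sub>il\<^esup>) / (1 - X\<^bsup>-\<alpha>\<^sub>i\<^esup>)\<close> of the Bernstein
  relation. The fraction is a twisted derivation in \<open>l\<close>, hence determined by its values on generators
  of the lattice. Vectors that pair to \<open>-1\<close> with the coroot generate, and for them the fraction is a
  single monomial. The inductive form lets identities that are compatible with sums and negatives be
  proved by rule induction without ever evaluating the fraction.
\<close>

inductive divided_difference :: "node \<Rightarrow> lattice \<Rightarrow> (lattice \<Rightarrow>\<^sub>0 complex) \<Rightarrow> bool" for i where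
  base: "pairing l i = -1 \<Longrightarrow> divided_difference i l (- Poly_Mapping.single (reflection i l) 1)"
| add: "divided_difference i l f \<Longrightarrow> divided_difference i m g \<Longrightarrow>
    divided_difference i (l + m)
      (f * Poly_Mapping.single (reflection i m) 1 + Poly_Mapping.single l 1 * g)"
| neg: "divided_difference i l f \<Longrightarrow>
    divided_difference i (- l)
      (- (Poly_Mapping.single (- l) 1 * f * Poly_Mapping.single (- reflection i l) 1))"

lemma reflection_add: "reflection i (l + m) = reflection i l + reflection i m"
  by (cases i) (auto simp: reflection_def pairing_def algebra_simps prod_eq_iff)

lemma reflection_uminus: "reflection i (- l) = - reflection i l"
  by (cases i) (auto simp: reflection_def pairing_def algebra_simps prod_eq_iff)

lemma reflection_pairing_neg_one:
  "pairing l i = -1 \<Longrightarrow> reflection i l = l + simple_root i"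
  by (cases i) (auto simp: reflection_def prod_eq_iff)

text \<open>
  The lattice is generated by \<open>(1, 1)\<close> and \<open>(4, 3)\<close>, and also by \<open>(1, 0)\<close> and \<open>(3, 1)\<close>; these pairs
  consist of vectors that pair to \<open>-1\<close> with the first and with the second coroot, respectively.
\<close>

lemma divided_difference_exists: "\<exists>f. divided_difference i l f"
proof -
  let ?P = "\<lambda>l. \<exists>f. divided_difference i l f"
  have padd: "?P (l + m)" if "?P l" "?P m" for l m
    using that divided_difference.add by blast
  have pneg: "?P (- l)" if "?P l" for l
    using that divided_difference.neg by blast
  have pmul: "?P (n * fst l, n * snd l)" if "?P l" for n l
  proof (induction n rule: int_induct[where k = 0])
    case base
    from padd[OF that pneg[OF that]] have "?P 0" by simp
    then show ?case by (simp add: zero_prod_def)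
  next
    case (step1 n)
    from padd[OF step1(2) that] show ?case by (simp add: algebra_simps plus_prod_def)
  next
    case (step2 n)
    from padd[OF step2(2) pneg[OF that]] show ?case
      by (simp add: algebra_simps plus_prod_def uminus_prod_def)
  qed
  obtain a b where l: "l = (a, b)" by force
  show ?thesis
  proof (cases i)
    case Node1
    have "?P (1, 1)" "?P (4, 3)"
      by (rule exI, rule divided_difference.base, simp add: Node1 pairing_def)+
    from padd[OF pmul[OF this(1), of "4 * b - 3 * a"] pmul[OF this(2), of "a - b"]]
    show ?thesis by (simp add: l algebra_simps)
  next
    case Node2
    have "?P (1, 0)" "?P (3, 1)"
      by (rule exI, rule divided_difference.base, simp add: Node2 pairing_def)+
    from padd[OF pmul[OF this(1), of "a - 3 * b"] pmul[OF this(2), of b]]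
    show ?thesis by (simp add: l algebra_simps)
  qed
qed

lemma divided_difference_equation:
  assumes "divided_difference i l f"
  shows "f * (1 - Poly_Mapping.single (- simple_root i) 1)
       = Poly_Mapping.single l 1 - Poly_Mapping.single (reflection i l) 1"
  using assms
proof induction
  case (base l)
  show ?case
    by (simp add: reflection_pairing_neg_one[OF base] algebra_simps mult_single)
next
  case (add l f m g)
  let ?Y = "1 - Poly_Mapping.single (- simple_root i) (1 :: complex)"
  let ?X = "\<lambda>l :: lattice. Poly_Mapping.single l (1 :: complex)"
  have regroup: "(f * x + y * g) * z = (f * z) * x + y * (g * z)"
    for f g x y z :: "lattice \<Rightarrow>\<^sub>0 complex"
    by (simp add: algebra_simps)
  have "(f * ?X (reflection i m) + ?X l * g) * ?Y
      = (f * ?Y) * ?X (reflection i m) + ?X l * (g * ?Y)"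
    by (rule regroup)
  also have "\<dots> = ?X (l + m) - ?X (reflection i (l + m))"
    unfolding add.IH by (simp add: algebra_simps mult_single reflection_add)
  finally show ?case .
next
  case (neg l f)
  let ?Y = "1 - Poly_Mapping.single (- simple_root i) (1 :: complex)"
  let ?X = "\<lambda>l :: lattice. Poly_Mapping.single l (1 :: complex)"
  have "(- (?X (- l) * f * ?X (- reflection i l))) * ?Y
      = - (?X (- l) * ?X (- reflection i l) * (f * ?Y))"
    by (simp only: mult_ac minus_mult_left minus_mult_right)
  also have "\<dots> = ?X (- l) - ?X (reflection i (- l))"
    unfolding neg.IH by (simp add: algebra_simps mult_single reflection_uminus)
  finally show ?case .
qed

text \<open>
  The hypothesis makes the coefficients of \<open>g\<close> constant along every line in the direction of the
  simple root, and a finitely supported function that is constant along such lines vanishes.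
\<close>

lemma simple_root_translate_cancel:
  fixes g :: "lattice \<Rightarrow>\<^sub>0 complex"
  assumes "g * (1 - Poly_Mapping.single (- simple_root i) 1) = 0"
  shows "g = 0"
proof (rule ccontr)
  assume "g \<noteq> 0"
  then obtain m where m: "Poly_Mapping.lookup g m \<noteq> 0"
    by (metis lookup_zero poly_mapping_eqI)
  let ?Y = "Poly_Mapping.single (- simple_root i) (1 :: complex)"
  \<comment> \<open>multiplication by \<open>X\<^bsup>-\<alpha>\<^esup>\<close> shifts coefficients\<close>
  have look: "Poly_Mapping.lookup (g * ?Y) l = Poly_Mapping.lookup g (l + simple_root i)" for l
  proof (induction g rule: poly_mapping_single_plus_induct)
    case (single k v)
    have "k - simple_root i = l \<longleftrightarrow> k = l + simple_root i" by (auto simp: algebra_simps)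
    then show ?case by (simp add: mult_single lookup_single when_def)
  next
    case (plus f g)
    then show ?case by (simp add: distrib_right lookup_add)
  qed
  have "g = g * ?Y" using assms by (simp add: algebra_simps)
  then have step: "Poly_Mapping.lookup g l = Poly_Mapping.lookup g (l + simple_root i)" for l
    using look[of l] by simp
  \<comment> \<open>the orbit of a point of the support under translation: infinite, yet contained in the support\<close>
  define orb where "orb n = ((\<lambda>l. l + simple_root i) ^^ n) m" for n
  have orb_eq: "orb n = (fst m + int n * fst (simple_root i), snd m + int n * snd (simple_root i))" for n
    by (induction n) (auto simp: orb_def algebra_simps plus_prod_def)
  have "orb n \<in> Poly_Mapping.keys g" for n
    by (induction n) (use m step in \<open>auto simp: orb_def in_keys_iff\<close>)
  then have "range orb \<subseteq> Poly_Mapping.keys g" by auto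
  then have "finite (range orb)" by (rule finite_subset) simp
  moreover have "inj orb" by (cases i) (auto simp: inj_on_def orb_eq)
  ultimately show False using finite_imageD by blast
qed

lemma divided_difference_unique:
  assumes "f * (1 - Poly_Mapping.single (- simple_root i) 1)
       = Poly_Mapping.single l 1 - Poly_Mapping.single (reflection i l) 1"
  shows "divided_difference i l f"
proof -
  obtain g where g: "divided_difference i l g" using divided_difference_exists by blast
  have "(f - g) * (1 - Poly_Mapping.single (- simple_root i) 1) = 0"
    unfolding left_diff_distrib using assms divided_difference_equation[OF g] by simp
  then have "f - g = 0" by (rule simple_root_translate_cancel)
  then show ?thesis using g by simp
qed

section \<open>The six-dimensional model\<close>

type_synonym vec = "complex \<times> complex \<times> complex \<times> complex \<times> complex \<times> complex"

fun scl :: "complex \<Rightarrow> vec \<Rightarrow> vec" where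
  "scl z (a, b, c, d, e, f) = (z * a, z * b, z * c, z * d, z * e, z * f)"

lemma zero_vec: "(0 :: vec) = (0, 0, 0, 0, 0, 0)"
  by (simp add: zero_prod_def)

interpretation vec: vector_space scl
  by unfold_locales (auto simp: algebra_simps)

text \<open>
  The basis vector \<open>e\<^sub>1\<close> plays the role of \<open>1 \<otimes> v\<^sub>t\<close>, and \<open>e\<^sub>2 = T\<^sub>1e\<^sub>1\<close>. The vectors \<open>e\<^sub>3\<close>, \<open>e\<^sub>4\<close>, \<open>e\<^sub>5\<close>, \<open>e\<^sub>6\<close> are
  weight vectors for \<open>s\<^sub>2t\<close>, \<open>s\<^sub>1s\<^sub>2t\<close>, \<open>s\<^sub>2s\<^sub>1s\<^sub>2t\<close>, \<open>s\<^sub>1s\<^sub>2s\<^sub>1s\<^sub>2t\<close>, each obtained from its predecessor by the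
  intertwiner \<open>T\<^sub>i - (q - q\<^sup>-\<^sup>1) / (1 - X\<^bsup>-\<alpha>\<^sub>i\<^esup>)\<close>. In particular
  \<open>e\<^sub>3 = T\<^sub>2e\<^sub>2 - qe\<^sub>2 - 3e\<^sub>1\<close>, where the term \<open>3e\<^sub>1\<close> comes from the nilpotent part of \<open>X\<^sup>\<lambda>\<close> on the generalized
  weight space of \<open>t\<close>. The coefficient \<open>(q\<^sup>4 + q\<^sup>2 + 1) / (q\<^sup>2 + 1)\<^sup>2\<close> with which \<open>T\<^sub>2\<close> leads from \<open>e\<^sub>5\<close> back to
  \<open>e\<^sub>4\<close> is forced by the quadratic relation; \<open>T\<^sub>1\<close> leads neither from \<open>e\<^sub>4\<close> back to \<open>e\<^sub>3\<close> nor from \<open>e\<^sub>6\<close>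
  back to \<open>e\<^sub>5\<close>.
\<close>

fun opT :: "complex \<Rightarrow> node \<Rightarrow> vec \<Rightarrow> vec" where
  "opT q Node1 (a, b, c, d, e, f) =
     (b, a + (q - inverse q) * b, q * c, c - inverse q * d, q * e, e - inverse q * f)"
| "opT q Node2 (a, b, c, d, e, f) =
     (q * a + 3 * b - 3 * (q + inverse q) * c, q * b, b - inverse q * c,
      q ^ 3 * inverse (q ^ 2 + 1) * d + (q ^ 4 + q ^ 2 + 1) * inverse (q ^ 2 + 1) ^ 2 * e,
      d - inverse q * inverse (q ^ 2 + 1) * e, q * f)"

text \<open>
  On the span of \<open>e\<^sub>1\<close> and \<open>e\<^sub>2\<close> the action is not semisimple: the Bernstein relation gives
  \<open>X\<^sup>\<lambda>T\<^sub>1v\<^sub>t = t(X\<^sup>\<lambda>)T\<^sub>1v\<^sub>t + (q - q\<^sup>-\<^sup>1)cv\<^sub>t\<close>, where \<open>c\<close> is the limit of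
  \<open>(X\<^sup>\<lambda> - X\<^bsup>s\<^sub>1\<lambda>\<^esup>) / (1 - X\<^bsup>-\<alpha>\<^sub>1\<^esup>)\<close> at \<open>t\<close>, that is, \<open>t(X\<^sup>\<lambda>)\<close> times the pairing of \<open>\<lambda>\<close> with the first coroot.
\<close>

fun opX :: "complex \<Rightarrow> lattice \<Rightarrow> vec \<Rightarrow> vec" where
  "opX q (m, n) (a, b, c, d, e, f) =
     (q powi (2 * n) * (a + (q - inverse q) * of_int (2 * m - 3 * n) * b), q powi (2 * n) * b,
      q powi (2 * m - 2 * n) * c, q powi (4 * n - 2 * m) * d,
      q powi (2 * m - 4 * n) * e, q powi (2 * n - 2 * m) * f)"

fun op_letter :: "complex \<Rightarrow> gen \<Rightarrow> vec \<Rightarrow> vec" where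
  "op_letter q (T i) x = opT q i x"
| "op_letter q (X l) x = opX q l x"

definition op_word :: "complex \<Rightarrow> word \<Rightarrow> vec \<Rightarrow> vec" where
  "op_word q w x = foldr (op_letter q) (letters w) x"

lemma op_letter_add: "op_letter q g (x + y) = op_letter q g x + op_letter q g y"
proof (cases g)
  case (T i)
  then show ?thesis by (cases i; cases x; cases y) (simp_all add: algebra_simps)
next
  case (X l)
  then show ?thesis by (cases l; cases x; cases y) (simp add: algebra_simps)
qed

lemma op_letter_scale: "op_letter q g (scl z x) = scl z (op_letter q g x)"
proof (cases g)
  case (T i)
  then show ?thesis by (cases i; cases x) (simp_all add: algebra_simps)
next
  case (X l)
  then show ?thesis by (cases l; cases x) (simp add: algebra_simps)
qed

interpretation word_rep: monoid_rep scl "op_word q" for q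
proof
  fix a b :: word and x y :: vec and c :: complex
  show "op_word q 0 x = x" by (simp add: op_word_def zero_word_def)
  show "op_word q (a + b) x = op_word q a (op_word q b x)"
    by (simp add: op_word_def plus_word_def)
  have "foldr (op_letter q) ws (x + y) = foldr (op_letter q) ws x + foldr (op_letter q) ws y" for ws
    by (induction ws) (simp_all add: op_letter_add)
  then show "op_word q a (x + y) = op_word q a x + op_word q a y" by (simp add: op_word_def)
  have "foldr (op_letter q) ws (scl c x) = scl c (foldr (op_letter q) ws x)" for ws
    by (induction ws) (simp_all add: op_letter_scale)
  then show "op_word q a (scl c x) = scl c (op_word q a x)" by (simp add: op_word_def)
qed

abbreviation act :: "complex \<Rightarrow> free_algebra \<Rightarrow> vec \<Rightarrow> vec" where
  "act \<equiv> word_rep.act"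

lemma act_fscal [simp]: "act q (fscal c) x = scl c x"
  by (simp add: fscal_def word_rep.op_zero)

lemma act_fT [simp]: "act q (fT i) x = opT q i x"
  by (simp add: fT_def op_word_def)

lemma act_fX [simp]: "act q (fX l) x = opX q l x"
  by (simp add: fX_def op_word_def)

locale hecke_parameter =
  fixes q :: complex
  assumes q0: "q \<noteq> 0" and q1: "q ^ 2 \<noteq> 1" and qm1: "q ^ 2 \<noteq> -1"
begin

lemma q2p1: "q ^ 2 + 1 \<noteq> 0" "1 + q ^ 2 \<noteq> 0" "1 + q * q \<noteq> 0" "q * q + 1 \<noteq> 0"
  using qm1 by (auto simp: power2_eq_square add_eq_0_iff add.commute)

interpretation lattice_rep: monoid_rep scl "opX q"
proof
  fix a b :: lattice and x y :: vec and c :: complex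
  show "opX q 0 x = x" by (cases x) (simp add: zero_prod_def)
  show "opX q (a + b) x = opX q a (opX q b x)"
    using q0 by (cases a; cases b; cases x)
      (simp add: algebra_simps power_int_add power_int_diff)
  show "opX q a (x + y) = opX q a x + opX q a y"
    using op_letter_add[of q "X a"] by simp
  show "opX q a (scl c x) = scl c (opX q a x)"
    using op_letter_scale[of q "X a"] by simp
qed

lemma act_fXlin: "act q (fXlin f) x = lattice_rep.act f x"
  by (simp add: fXlin_def word_rep.act_sum word_rep.act_mult lattice_rep.act_def)

text \<open>
  Read from left to right, these are the partial fraction rules for \<open>\<complex>[q, q\<^sup>-\<^sup>1, (q\<^sup>2 + 1)\<^sup>-\<^sup>1]\<close>. Together with
  distributivity they bring every element into a normal form, so that identities in this ring become
  decidable by rewriting. Each rule appears a second time with a factor \<open>x\<close> to the right, as needed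
  for rewriting modulo associativity and commutativity.
\<close>

lemma laurent_normalisation:
  defines "p \<equiv> inverse q" and "r \<equiv> inverse (q ^ 2 + 1)"
  shows "p * q = 1" "p * (q * x) = x"
    "q * r = p - p * r" "q * (r * x) = p * x - p * (r * x)"
    "p * (p * r) = p * p - r" "p * (p * (r * x)) = p * (p * x) - r * x"
proof -
  have p: "p * q = 1" and r: "r * (q ^ 2 + 1) = 1"
    using q0 q2p1 by (simp_all add: p_def r_def)
  show "p * q = 1" by (rule p)
  show "p * (q * x) = x" by (simp add: p flip: mult.assoc)
  have "p * (r * (q ^ 2 + 1)) = (p * q) * (q * r) + p * r"
    by (simp add: algebra_simps power2_eq_square)
  then have "p = q * r + p * r" by (simp only: p r mult_1_left mult_1_right)
  then show qr: "q * r = p - p * r" by (simp add: eq_diff_eq)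
  show "q * (r * x) = p * x - p * (r * x)"
    by (simp add: qr left_diff_distrib flip: mult.assoc)
  have "p * p * (r * (q ^ 2 + 1)) = (p * q) * (p * q) * r + p * (p * r)"
    by (simp add: algebra_simps power2_eq_square)
  then have "p * p = r + p * (p * r)" by (simp only: p r mult_1_left mult_1_right)
  then show pr: "p * (p * r) = p * p - r" by (simp add: eq_diff_eq add.commute)
  have "p * p * r = p * p - r" using pr by (simp add: mult.assoc)
  then show "p * (p * (r * x)) = p * (p * x) - r * x"
    by (simp add: left_diff_distrib flip: mult.assoc)
qed

lemma quadratic_relation: "opT q i (opT q i x) = scl (q - inverse q) (opT q i x) + x"
proof -
  obtain a b c d e f where x: "x = (a, b, c, d, e, f)" by (metis prod.exhaust)
  define p where "p = inverse q"
  define r where "r = inverse (q ^ 2 + 1)"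
  note norm = laurent_normalisation[folded p_def r_def]
  show ?thesis
    by (cases i; simp add: x flip: p_def r_def)
      (simp_all add: norm algebra_simps power2_eq_square power3_eq_cube power4_eq_xxxx)
qed

lemma braid_relation:
  "opT q Node1 (opT q Node2 (opT q Node1 (opT q Node2 (opT q Node1 (opT q Node2 x)))))
   = opT q Node2 (opT q Node1 (opT q Node2 (opT q Node1 (opT q Node2 (opT q Node1 x)))))"
proof -
  obtain a b c d e f where x: "x = (a, b, c, d, e, f)" by (metis prod.exhaust)
  define p where "p = inverse q"
  define r where "r = inverse (q ^ 2 + 1)"
  note norm = laurent_normalisation[folded p_def r_def]
  show ?thesis
    unfolding x opT.simps p_def[symmetric] r_def[symmetric] prod.inject
    by (intro conjI)
      (simp_all add: norm algebra_simps power2_eq_square power3_eq_cube power4_eq_xxxx)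
qed

text \<open>
  For a vector that pairs to \<open>-1\<close> with the coroot, the fraction in the Bernstein relation is \<open>- X\<^bsup>s\<^sub>il\<^esup>\<close>.
  In the proof, all exponents are expressed through a single integer by means of the linear equation
  between the coordinates of \<open>l\<close>.
\<close>

lemma bernstein_base:
  assumes "pairing l i = -1"
  shows "opX q l (opT q i x)
    = opT q i (opX q (reflection i l) x) - scl (q - inverse q) (opX q (reflection i l) x)"
proof -
  obtain m n where l: "l = (m, n)" by force
  obtain a b c d e f where x: "x = (a, b, c, d, e, f)" by (metis prod.exhaust)
  define p where "p = inverse q"
  define r where "r = inverse (q ^ 2 + 1)"
  note norm = laurent_normalisation[folded p_def r_def]
  have pow2: "q powi (s + 2) = q * (q * q powi s)" "q powi (- s - 2) = p * (p * q powi (- s))" for s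
    using q0 by (simp_all add: p_def power_int_add power_int_diff power2_eq_square field_simps)
  show ?thesis
  proof (cases i)
    case Node1
    then have n: "3 * n = 2 * m + 1" using assms by (simp add: l pairing_def)
    \<comment> \<open>the exponent of the third weight; the reflected one is \<open>s + 2\<close>\<close>
    define s where "s = 2 * m - 2 * n"
    have exps: "2 * m - 2 * n = s" "4 * n - 2 * m = s + 2" "2 * m - 4 * n = - s - 2" "2 * n - 2 * m = - s"
      "2 * (m + 1) - 2 * n = s + 2" "4 * n - 2 * (m + 1) = s" "2 * (m + 1) - 4 * n = - s"
      "2 * n - 2 * (m + 1) = - s - 2" "2 * m - 3 * n = - 1" "2 * (m + 1) - 3 * n = 1"
      using n by (auto simp: s_def)
    have l': "reflection i l = (m + 1, n)"
      by (subst reflection_pairing_neg_one[OF assms]) (simp add: l Node1)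
    show ?thesis
      unfolding l'
      unfolding Node1 x l opT.simps opX.simps exps
        pow2 p_def[symmetric] r_def[symmetric]
      by (simp add: norm algebra_simps)
  next
    case Node2
    then have m: "m = 2 * n + 1" using assms by (simp add: l pairing_def)
    \<comment> \<open>the summand \<open>0\<close> lets the two shift rules for powers apply to constant exponents as well\<close>
    have exps: "2 * m - 2 * n = 2 * n + 2" "4 * n - 2 * m = - 0 - 2"
      "2 * m - 4 * n = 0 + 2" "2 * n - 2 * m = - (2 * n) - 2"
      "2 * (n + 1) = 2 * n + 2" "2 * m - (2 * n + 2) = 2 * n"
      "4 * (n + 1) - 2 * m = 0 + 2" "2 * m - 4 * (n + 1) = - 0 - 2"
      "2 * n + 2 - 2 * m = - (2 * n)" "2 * m - 3 * n = n + 2" "2 * m - 3 * (n + 1) = n - 1"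
      using m by auto
    have l': "reflection i l = (m, n + 1)"
      by (subst reflection_pairing_neg_one[OF assms]) (simp add: l Node2)
    show ?thesis
      unfolding l'
      unfolding Node2 x l opT.simps opX.simps exps
      unfolding pow2 p_def[symmetric] r_def[symmetric]
      by (simp add: norm algebra_simps power2_eq_square power3_eq_cube power4_eq_xxxx)
  qed
qed

lemma opX_plus: "opX q (l + m) x = opX q l (opX q m x)"
  by (rule lattice_rep.op_plus)

lemma opX_zero: "opX q 0 x = x"
  by (rule lattice_rep.op_zero)

lemma opX_uminus: "opX q (- l) (opX q l x) = x" "opX q l (opX q (- l) x) = x"
  by (simp_all flip: opX_plus add: opX_zero)

text \<open>
  Both sides of the relation are twisted derivations in \<open>l\<close>, so the base case suffices.
\<close>

lemma bernstein_relation: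
  assumes "divided_difference i l f"
  shows "opX q l (opT q i x)
    = opT q i (opX q (reflection i l) x) + scl (q - inverse q) (lattice_rep.act f x)"
  using assms
proof (induction arbitrary: x)
  case (base l)
  then show ?case by (simp add: bernstein_base lattice_rep.act_uminus)
next
  case (add l f m g)
  then show ?case
    by (simp add: opX_plus lattice_rep.op_add lattice_rep.op_scale lattice_rep.act_mult lattice_rep.act_plus reflection_add
        vec.scale_right_distrib)
next
  case (neg l f)
  define y where "y = opX q (- reflection i l) x"
  have x: "x = opX q (reflection i l) y" by (simp add: y_def opX_uminus)
  have "opT q i y = opX q (- l) (opX q l (opT q i y))" by (simp add: opX_uminus)
  also have "\<dots> = opX q (- l) (opT q i x) + scl (q - inverse q) (opX q (- l) (lattice_rep.act f y))"
    unfolding neg.IH by (simp add: x lattice_rep.op_add lattice_rep.op_scale)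
  finally show ?case
    by (simp add: y_def[symmetric] reflection_uminus lattice_rep.act_uminus lattice_rep.act_mult)
qed

theorem act_hecke_relations:
  assumes "r \<in> hecke_relations q"
  shows "act q r x = 0"
  using assms
proof cases
  case X_zero
  then show ?thesis by (simp add: word_rep.act_diff opX_zero)
next
  case (X_add l m)
  then show ?thesis by (simp add: word_rep.act_diff word_rep.act_mult opX_plus)
next
  case (quadratic i)
  then show ?thesis
    by (simp add: word_rep.act_diff word_rep.act_plus word_rep.act_mult power2_eq_square quadratic_relation)
next
  case braid
  then show ?thesis by (simp add: word_rep.act_diff word_rep.act_mult braid_relation)
next
  case (bernstein f i l)
  then show ?thesis
    using bernstein_relation[OF divided_difference_unique[OF bernstein(2)]]
    by (simp add: word_rep.act_diff word_rep.act_plus word_rep.act_mult act_fXlin)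
qed

end

section \<open>The annihilator of the generator\<close>

definition e1 :: vec where "e1 = (1, 0, 0, 0, 0, 0)"

context hecke_parameter
begin

text \<open>
  The elements \<open>h\<^sub>2, \<dots>, h\<^sub>6\<close> produce the other basis vectors from \<open>e\<^sub>1\<close>. From \<open>h\<^sub>3\<close> on they are products of
  intertwiners in which the fraction is replaced by its value at the weight concerned; the additional
  \<open>3\<close> in \<open>h\<^sub>3\<close> corrects for the nilpotent part.
\<close>

lemma act_e1_surj: "\<exists>f. act q f e1 = x"
proof -
  obtain a b c d e g where x: "x = (a, b, c, d, e, g)" by (metis prod.exhaust)
  let ?k = "\<lambda>i z h. fT i * h - fscal z * h"
  define h2 where "h2 = fT Node1 * (1 :: free_algebra)"
  define h3 where "h3 = ?k Node2 q h2 - fscal 3"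
  define h4 where "h4 = ?k Node1 q h3"
  define h5 where "h5 = ?k Node2 (q ^ 3 * inverse (q ^ 2 + 1)) h4"
  define h6 where "h6 = ?k Node1 q h5"
  note simps = word_rep.act_diff word_rep.act_mult word_rep.act_plus e1_def
  have h2: "act q h2 e1 = (0, 1, 0, 0, 0, 0)"
    by (simp add: h2_def simps)
  have h3: "act q h3 e1 = (0, 0, 1, 0, 0, 0)"
    unfolding h3_def word_rep.act_diff word_rep.act_mult h2 by (simp add: e1_def zero_prod_def)
  have h4: "act q h4 e1 = (0, 0, 0, 1, 0, 0)"
    unfolding h4_def word_rep.act_diff word_rep.act_mult h3 by (simp add: zero_prod_def)
  have h5: "act q h5 e1 = (0, 0, 0, 0, 1, 0)"
    unfolding h5_def word_rep.act_diff word_rep.act_mult h4 by (simp add: zero_prod_def)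
  have h6: "act q h6 e1 = (0, 0, 0, 0, 0, 1)"
    unfolding h6_def word_rep.act_diff word_rep.act_mult h5 by (simp add: zero_prod_def)
  have "act q (fscal a + fscal b * h2 + fscal c * h3 + fscal d * h4 + fscal e * h5 + fscal g * h6) e1 = x"
    unfolding word_rep.act_plus word_rep.act_mult h2 h3 h4 h5 h6 act_fscal
    unfolding x e1_def by (simp add: zero_prod_def)
  then show ?thesis by blast
qed

end

lemma fscal_commute: "fscal c * f = f * fscal c"
  by (induction f rule: poly_mapping_single_plus_induct)
    (simp_all add: fscal_def mult_single distrib_left distrib_right mult.commute)

lemma fscal_add: "fscal (a + b) = fscal a + fscal b"
  by (simp add: fscal_def single_add)

lemma fscal_mult: "fscal (a * b) = fscal a * fscal b"
  by (simp add: fscal_def mult_single)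

lemma fscal_zero [simp]: "fscal 0 = 0"
  by (simp add: fscal_def)

lemma fscal_one [simp]: "fscal 1 = 1"
  by (simp add: fscal_def)

lemma fscal_uminus: "fscal (- a) = - fscal a"
  by (simp add: fscal_def single_uminus)

lemma free_algebra_induct [case_names one plus scale T X]:
  assumes one: "P 1"
    and plus: "\<And>f g. P f \<Longrightarrow> P g \<Longrightarrow> P (f + g)"
    and scale: "\<And>c f. P f \<Longrightarrow> P (fscal c * f)"
    and T: "\<And>i f. P f \<Longrightarrow> P (fT i * f)"
    and X: "\<And>l f. P f \<Longrightarrow> P (fX l * f)"
  shows "P f"
proof (induction f rule: poly_mapping_single_plus_induct)
  case (single w c)
  have "P (Poly_Mapping.single (Word ws) 1)" for ws
  proof (induction ws)
    case Nil
    then show ?case using one by (simp flip: zero_word_def)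
  next
    case (Cons g ws)
    have "Poly_Mapping.single (Word (g # ws)) (1 :: complex)
        = Poly_Mapping.single (Word [g]) 1 * Poly_Mapping.single (Word ws) 1"
      by (simp add: mult_single plus_word_def)
    then show ?case
      using T[OF Cons] X[OF Cons] by (cases g) (simp_all add: fT_def fX_def)
  qed
  from scale[OF this, of c "letters w"] show ?case
    by (simp add: fscal_def mult_single)
next
  case (plus f g)
  then show ?case by (rule assms(2))
qed

text \<open>
  \<open>J\<close> is to be the annihilator of the generator \<open>1 \<otimes> v\<^sub>t\<close> of the induced module, pulled back to the
  free algebra. The assumptions up to \<open>J_X\<close> express that the generator satisfies the relations that
  define the induced module, and \<open>J_act\<close> that the module maps to the model. Working with a left ideal
  keeps all computations inside the ring type of the free algebra.
\<close>

locale cyclic_presentation = hecke_parameter +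
  fixes J :: "free_algebra set"
  assumes J_zero: "0 \<in> J"
    and J_diff: "f \<in> J \<Longrightarrow> g \<in> J \<Longrightarrow> f - g \<in> J"
    and J_mult: "f \<in> J \<Longrightarrow> h * f \<in> J"
    and J_relations: "r \<in> hecke_relations q \<Longrightarrow> r * h \<in> J"
    and J_T2: "fT Node2 - fscal q \<in> J"
    and J_X: "fX l - fscal (q powi (2 * snd l)) \<in> J"
    and J_act: "f \<in> J \<Longrightarrow> act q f e1 = 0"
begin

lemma J_uminus: "f \<in> J \<Longrightarrow> - f \<in> J"
  using J_diff[OF J_zero] by simp

lemma J_add: "f \<in> J \<Longrightarrow> g \<in> J \<Longrightarrow> f + g \<in> J"
  using J_diff[of f "- g"] J_uminus by simp

abbreviation T1 :: free_algebra where "T1 \<equiv> fT Node1"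
abbreviation T2 :: free_algebra where "T2 \<equiv> fT Node2"

text \<open>
  The combinations of the elements \<open>T\<^sub>w\<close> with \<open>w\<close> a minimal representative of a coset of \<open>\<langle>s\<^sub>2\<rangle>\<close>. Here the
  products \<open>T\<^sub>w\<close> are more convenient than the weight basis of the model, because \<open>T\<^sub>1\<close> and \<open>T\<^sub>2\<close>
  take each of them to another one up to the quadratic relation, with two exceptions for \<open>T\<^sub>2\<close>.
\<close>

fun combination :: "vec \<Rightarrow> free_algebra" where
  "combination (a, b, c, d, e, f) = fscal a + fscal b * T1 + fscal c * (T2 * T1)
     + fscal d * (T1 * (T2 * T1)) + fscal e * (T2 * (T1 * (T2 * T1)))
     + fscal f * (T1 * (T2 * (T1 * (T2 * T1))))"

lemma combination_add: "combination (x + y) = combination x + combination y"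
  by (cases x; cases y) (simp add: fscal_add algebra_simps)

lemma combination_scale: "combination (scl z x) = fscal z * combination x"
  by (cases x) (simp add: fscal_mult distrib_left mult.assoc)

text \<open>
  With respect to the weight basis, the images \<open>T\<^sub>we\<^sub>1\<close> form a unitriangular matrix, so the coefficients
  vanish one after the other, beginning with the last.
\<close>

lemma act_combination_zero:
  assumes "act q (combination x) e1 = 0" shows "x = 0"
proof -
  obtain a b c d e g where x: "x = (a, b, c, d, e, g)" by (metis prod.exhaust)
  have *: "act q (combination x) e1 = 0 \<Longrightarrow> g = 0 \<and> e = 0 \<and> d = 0 \<and> c = 0 \<and> b = 0 \<and> a = 0"
    by (simp add: x word_rep.act_plus word_rep.act_mult e1_def zero_vec) (elim conjE, simp)
  show ?thesis using *[OF assms] by (simp add: x zero_vec)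
qed

definition spanned :: "free_algebra set" where
  "spanned = {f. \<exists>x. f - combination x \<in> J}"

lemma spannedI: "f - combination x \<in> J \<Longrightarrow> f \<in> spanned"
  unfolding spanned_def by blast

lemma spanned_combination: "combination x \<in> spanned"
  using J_zero by (intro spannedI[of _ x]) simp

lemma spanned_cong: "f - g \<in> J \<Longrightarrow> g \<in> spanned \<Longrightarrow> f \<in> spanned"
proof -
  assume fg: "f - g \<in> J" and "g \<in> spanned"
  then obtain x where "g - combination x \<in> J" unfolding spanned_def by blast
  from J_add[OF fg this] show ?thesis by (intro spannedI[of _ x]) simp
qed

lemma spanned_add: "f \<in> spanned \<Longrightarrow> g \<in> spanned \<Longrightarrow> f + g \<in> spanned"
proof -
  assume "f \<in> spanned" "g \<in> spanned"
  then obtain x y where "f - combination x \<in> J" "g - combination y \<in> J" unfolding spanned_def by blast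
  from J_add[OF this] have "(f + g) - combination (x + y) \<in> J" by (simp add: combination_add algebra_simps)
  then show ?thesis unfolding spanned_def by blast
qed

lemma spanned_scale: "f \<in> spanned \<Longrightarrow> fscal c * f \<in> spanned"
proof -
  assume "f \<in> spanned"
  then obtain x where "f - combination x \<in> J" unfolding spanned_def by blast
  from J_mult[OF this, of "fscal c"] have "fscal c * f - combination (scl c x) \<in> J"
    by (simp add: combination_scale algebra_simps)
  then show ?thesis unfolding spanned_def by blast
qed

lemma spanned_basis: "1 \<in> spanned" "T1 \<in> spanned" "T2 * T1 \<in> spanned" "T1 * (T2 * T1) \<in> spanned"
  "T2 * (T1 * (T2 * T1)) \<in> spanned" "T1 * (T2 * (T1 * (T2 * T1))) \<in> spanned"
  using spanned_combination[of "(1, 0, 0, 0, 0, 0)"] spanned_combination[of "(0, 1, 0, 0, 0, 0)"]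
    spanned_combination[of "(0, 0, 1, 0, 0, 0)"] spanned_combination[of "(0, 0, 0, 1, 0, 0)"]
    spanned_combination[of "(0, 0, 0, 0, 1, 0)"] spanned_combination[of "(0, 0, 0, 0, 0, 1)"] by simp_all

lemma spanned_left_mult:
  assumes basis: "h \<in> spanned" "h * T1 \<in> spanned" "h * (T2 * T1) \<in> spanned" "h * (T1 * (T2 * T1)) \<in> spanned"
    "h * (T2 * (T1 * (T2 * T1))) \<in> spanned" "h * (T1 * (T2 * (T1 * (T2 * T1)))) \<in> spanned"
    and f: "f \<in> spanned"
  shows "h * f \<in> spanned"
proof -
  obtain x where x: "f - combination x \<in> J" using f unfolding spanned_def by blast
  have swap: "h * (fscal z * g) = fscal z * (h * g)" for z g
    by (metis fscal_commute mult.assoc)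
  have "h * combination x \<in> spanned"
    by (cases x) (auto simp: distrib_left swap swap[of _ 1, simplified] intro!: spanned_add spanned_scale basis)
  moreover have "h * f - h * combination x \<in> J" using J_mult[OF x, of h] by (simp add: algebra_simps)
  ultimately show ?thesis using spanned_cong by blast
qed

lemma spanned_quadratic:
  assumes "f \<in> spanned" "fT i * f \<in> spanned"
  shows "fT i * (fT i * f) \<in> spanned"
proof (rule spanned_cong)
  show "fT i * (fT i * f) - (fscal (q - inverse q) * (fT i * f) + f) \<in> J"
    using J_relations[OF hecke_relations.quadratic, of i f]
    by (simp add: algebra_simps power2_eq_square)
  show "fscal (q - inverse q) * (fT i * f) + f \<in> spanned"
    using assms by (intro spanned_add spanned_scale)
qed

lemma spanned_T1:
  assumes "f \<in> spanned"
  shows "T1 * f \<in> spanned"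
proof -
  have 2: "T1 * T1 \<in> spanned"
    using spanned_quadratic[OF spanned_basis(1), of Node1] spanned_basis(2) by simp
  show ?thesis
    by (rule spanned_left_mult[OF spanned_basis(2) 2 spanned_basis(4) spanned_quadratic[OF spanned_basis(3,4)]
          spanned_basis(6) spanned_quadratic[OF spanned_basis(5,6)] assms])
qed

text \<open>
  The only products that the quadratic relation does not settle are \<open>T\<^sub>2\<close> itself, which acts as \<open>q\<close>, and
  \<open>T\<^sub>2T\<^sub>1T\<^sub>2T\<^sub>1T\<^sub>2T\<^sub>1\<close>, which the braid relation turns into a word ending in \<open>T\<^sub>2\<close>.
\<close>

lemma spanned_T2:
  assumes "f \<in> spanned"
  shows "T2 * f \<in> spanned"
proof -
  have 1: "T2 \<in> spanned"
    using spanned_cong[OF J_T2] spanned_scale[OF spanned_basis(1), of q] by simp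
  have fscal_right: "a * (b * fscal q) = fscal q * (a * b)" "a * fscal q = fscal q * a"
    for a b :: free_algebra
    by (metis fscal_commute mult.assoc)+
  have "T1 * T2 * T1 * T2 * T1 * (T2 - fscal q)
      - (T1 * T2 * T1 * T2 * T1 * T2 - T2 * T1 * T2 * T1 * T2 * T1) * 1 \<in> J"
    by (intro J_diff J_mult J_T2 J_relations hecke_relations.braid)
  also have "T1 * T2 * T1 * T2 * T1 * (T2 - fscal q)
      - (T1 * T2 * T1 * T2 * T1 * T2 - T2 * T1 * T2 * T1 * T2 * T1) * 1
    = T2 * (T1 * (T2 * (T1 * (T2 * T1)))) - fscal q * (T1 * (T2 * (T1 * (T2 * T1))))"
    by (simp add: right_diff_distrib mult.assoc fscal_right)
  finally have 6: "T2 * (T1 * (T2 * (T1 * (T2 * T1)))) \<in> spanned"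
    using spanned_cong spanned_scale spanned_basis by blast
  show ?thesis
    by (rule spanned_left_mult[OF 1 spanned_basis(3) spanned_quadratic[OF spanned_basis(2,3)] spanned_basis(5)
          spanned_quadratic[OF spanned_basis(4,5)] 6 assms])
qed

lemma spanned_T: "f \<in> spanned \<Longrightarrow> fT i * f \<in> spanned"
  by (cases i) (simp_all add: spanned_T1 spanned_T2)

lemma spanned_sum: "(\<And>i. i \<in> I \<Longrightarrow> f i \<in> spanned) \<Longrightarrow> sum f I \<in> spanned"
  by (induction I rule: infinite_finite_induct)
    (use spanned_scale[OF spanned_basis(1), of 0] in \<open>auto intro: spanned_add\<close>)

text \<open>
  The Bernstein relation moves \<open>X\<^sup>l\<close> past \<open>T\<^sub>i\<close> at the cost of further lattice elements, which is why
  the hypothesis concerns all \<open>l\<close> at once.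
\<close>

lemma spanned_X_T:
  assumes "\<And>l. fX l * g \<in> spanned"
  shows "fX l * (fT i * g) \<in> spanned"
proof -
  obtain f where "divided_difference i l f" using divided_difference_exists by blast
  note rel = hecke_relations.bernstein[OF divided_difference_equation[OF this], of q]
  show ?thesis
  proof (rule spanned_cong)
    show "fX l * (fT i * g) - (fT i * (fX (reflection i l) * g)
        + fscal (q - inverse q) * (fXlin f * g)) \<in> J"
      using J_relations[OF rel, of g] by (simp add: algebra_simps)
    have "fXlin f * g \<in> spanned"
      by (simp add: fXlin_def sum_distrib_right mult.assoc spanned_sum spanned_scale assms)
    then show "fT i * (fX (reflection i l) * g) + fscal (q - inverse q) * (fXlin f * g) \<in> spanned"
      by (intro spanned_add spanned_scale spanned_T assms)
  qed
qed

lemma spanned_X: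
  assumes "f \<in> spanned"
  shows "fX l * f \<in> spanned"
proof -
  have 1: "fX l \<in> spanned" for l
    using spanned_cong[OF J_X[of l]] spanned_scale[OF spanned_basis(1), of "q powi (2 * snd l)"] by simp
  have 2: "fX l * T1 \<in> spanned" for l
    using spanned_X_T[of 1 l Node1] 1 by simp
  note 3 = spanned_X_T[OF 2, of _ Node2]
  note 4 = spanned_X_T[OF 3, of _ Node1]
  note 5 = spanned_X_T[OF 4, of _ Node2]
  note 6 = spanned_X_T[OF 5, of _ Node1]
  show ?thesis by (rule spanned_left_mult[OF 1 2 3 4 5 6 assms])
qed

lemma spanned_UNIV: "f \<in> spanned"
  by (induction f rule: free_algebra_induct) (auto intro: spanned_basis spanned_add spanned_scale spanned_T spanned_X)

text \<open>
  The induced module has dimension at most six, and its six spanning elements have independent images,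
  so the map to the model is injective.
\<close>

theorem act_zero_imp_J:
  assumes "act q f e1 = 0" shows "f \<in> J"
proof -
  obtain x where x: "f - combination x \<in> J" using spanned_UNIV[of f] unfolding spanned_def by blast
  then have "act q (combination x) e1 = 0" using J_act[OF x] assms by (simp add: word_rep.act_diff)
  then have "x = 0" by (rule act_combination_zero)
  then show ?thesis using x by (simp add: zero_vec)
qed

end

section \<open>Left modules and their quotients\<close>

text \<open>
  Quotients are constructed at the level of groups. Only carrier, addition and zero of a module record
  matter for its additive group, whatever the remaining fields are.
\<close>

lemma abelian_group_of_truncation:
  assumes "comm_group \<lparr>carrier = carrier M, monoid.mult = add M, one = \<zero>\<^bsub>M\<^esub>\<rparr>"
  shows "abelian_group M"
proof -
  interpret G: comm_group "\<lparr>carrier = carrier M, monoid.mult = add M, one = \<zero>\<^bsub>M\<^esub>\<rparr>" by fact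
  show ?thesis
    by (rule abelian_groupI)
      (use G.m_closed G.m_assoc G.m_comm G.l_one G.one_closed G.l_inv_ex in auto)
qed

context left_module
begin

lemma smult_zero_left:
  assumes "x \<in> carrier M"
  shows "\<zero>\<^bsub>R\<^esub> \<odot>\<^bsub>M\<^esub> x = \<zero>\<^bsub>M\<^esub>"
proof -
  have "\<zero>\<^bsub>R\<^esub> \<odot>\<^bsub>M\<^esub> x \<oplus>\<^bsub>M\<^esub> \<zero>\<^bsub>R\<^esub> \<odot>\<^bsub>M\<^esub> x = \<zero>\<^bsub>R\<^esub> \<odot>\<^bsub>M\<^esub> x"
    using smult_l_distr[symmetric, of "\<zero>\<^bsub>R\<^esub>" "\<zero>\<^bsub>R\<^esub>" x] assms by simp
  then show ?thesis using smult_closed[OF R.zero_closed assms] by (simp add: M.add.l_cancel_one)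
qed

lemma smult_zero_right:
  assumes "a \<in> carrier R"
  shows "a \<odot>\<^bsub>M\<^esub> \<zero>\<^bsub>M\<^esub> = \<zero>\<^bsub>M\<^esub>"
proof -
  have "a \<odot>\<^bsub>M\<^esub> (\<zero>\<^bsub>R\<^esub> \<odot>\<^bsub>M\<^esub> \<zero>\<^bsub>M\<^esub>) = (a \<otimes>\<^bsub>R\<^esub> \<zero>\<^bsub>R\<^esub>) \<odot>\<^bsub>M\<^esub> \<zero>\<^bsub>M\<^esub>"
    using assms by (simp only: smult_assoc R.zero_closed M.zero_closed)
  then show ?thesis using assms by (simp add: smult_zero_left)
qed

lemma smult_minus_one_add:
  "x \<in> carrier M \<Longrightarrow> (\<ominus>\<^bsub>R\<^esub> \<one>\<^bsub>R\<^esub>) \<odot>\<^bsub>M\<^esub> x \<oplus>\<^bsub>M\<^esub> x = \<zero>\<^bsub>M\<^esub>"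
  using smult_l_distr[of "\<ominus>\<^bsub>R\<^esub> \<one>\<^bsub>R\<^esub>" "\<one>\<^bsub>R\<^esub>" x] by (simp add: smult_one R.l_neg smult_zero_left)

lemma smult_minus_one:
  assumes "x \<in> carrier M"
  shows "(\<ominus>\<^bsub>R\<^esub> \<one>\<^bsub>R\<^esub>) \<odot>\<^bsub>M\<^esub> x = \<ominus>\<^bsub>M\<^esub> x"
  by (rule M.minus_equality[symmetric]) (use assms in \<open>auto intro: smult_minus_one_add smult_closed\<close>)

text \<open>
  Closure under additive inverses is automatic, as negation is multiplication by \<open>- 1\<close>.
\<close>

lemma submoduleI:
  assumes "U \<subseteq> carrier M" "\<zero>\<^bsub>M\<^esub> \<in> U"
    and "\<And>x y. x \<in> U \<Longrightarrow> y \<in> U \<Longrightarrow> x \<oplus>\<^bsub>M\<^esub> y \<in> U"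
    and smult: "\<And>a x. a \<in> carrier R \<Longrightarrow> x \<in> U \<Longrightarrow> a \<odot>\<^bsub>M\<^esub> x \<in> U"
  shows "submodule U R M"
proof -
  have "\<ominus>\<^bsub>M\<^esub> x \<in> U" if "x \<in> U" for x
    using smult[OF R.add.inv_closed[OF R.one_closed] that] smult_minus_one that assms(1) by auto
  then show ?thesis
    by (intro submodule.intro subgroup.intro submodule_axioms.intro)
      (use assms in \<open>auto simp: a_inv_def\<close>)
qed

lemma submoduleD:
  assumes "submodule U R M"
  shows "U \<subseteq> carrier M" "\<zero>\<^bsub>M\<^esub> \<in> U"
    and "\<And>x y. x \<in> U \<Longrightarrow> y \<in> U \<Longrightarrow> x \<oplus>\<^bsub>M\<^esub> y \<in> U"
    and "\<And>a x. a \<in> carrier R \<Longrightarrow> x \<in> U \<Longrightarrow> a \<odot>\<^bsub>M\<^esub> x \<in> U"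
proof -
  interpret U: submodule U R M by fact
  show "U \<subseteq> carrier M" "\<zero>\<^bsub>M\<^esub> \<in> U" using U.subset U.one_closed by auto
  show "x \<in> U \<Longrightarrow> y \<in> U \<Longrightarrow> x \<oplus>\<^bsub>M\<^esub> y \<in> U" for x y using U.m_closed by simp
  show "a \<in> carrier R \<Longrightarrow> x \<in> U \<Longrightarrow> a \<odot>\<^bsub>M\<^esub> x \<in> U" for a x by (rule U.smult_closed)
qed

lemma restrict_left_module:
  assumes "submodule U R M"
  shows "left_module R (M\<lparr>carrier := U\<rparr>)"
proof -
  note U = submoduleD[OF assms]
  have "abelian_group (M\<lparr>carrier := U\<rparr>)"
  proof (rule abelian_groupI)
    fix x y assume "x \<in> carrier (M\<lparr>carrier := U\<rparr>)" "y \<in> carrier (M\<lparr>carrier := U\<rparr>)"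
    then show "x \<oplus>\<^bsub>M\<lparr>carrier := U\<rparr>\<^esub> y = y \<oplus>\<^bsub>M\<lparr>carrier := U\<rparr>\<^esub> x"
      using U(1) M.a_comm[of x y] by auto
  next
    fix x assume "x \<in> carrier (M\<lparr>carrier := U\<rparr>)"
    then show "\<exists>y\<in>carrier (M\<lparr>carrier := U\<rparr>). y \<oplus>\<^bsub>M\<lparr>carrier := U\<rparr>\<^esub> x = \<zero>\<^bsub>M\<lparr>carrier := U\<rparr>\<^esub>"
      using U smult_minus_one_add by (intro bexI[of _ "(\<ominus>\<^bsub>R\<^esub> \<one>\<^bsub>R\<^esub>) \<odot>\<^bsub>M\<^esub> x"]) auto
  qed (use U in \<open>auto simp: M.a_assoc subset_iff\<close>)
  moreover have "left_module_axioms R (M\<lparr>carrier := U\<rparr>)"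
    using U by unfold_locales
      (auto simp: subset_iff smult_l_distr smult_r_distr smult_assoc smult_one)
  ultimately show ?thesis
    by (intro left_module.intro R.ring_axioms)
qed

end

locale module_quotient = left_module R M
  for R :: "('a, 'r) ring_scheme" (structure) and M :: "('a, 'b) module" (structure) +
  fixes U
  assumes U: "submodule U R M"
begin

abbreviation Q where "Q \<equiv> quotient_module M U"

lemma U_subgroup: "subgroup U (add_monoid M)"
  using U by (simp add: submodule_def)

sublocale U: abelian_subgroup U M
  by (rule abelian_subgroupI3[OF additive_subgroup.intro[OF U_subgroup] M.abelian_group_axioms])

lemma carrier_Q: "carrier Q = (\<lambda>x. U +>\<^bsub>M\<^esub> x) ` carrier M"
  by (auto simp: quotient_module_def A_RCOSETS_def')

lemma add_Q: "x \<in> carrier M \<Longrightarrow> y \<in> carrier M \<Longrightarrow>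
    (U +>\<^bsub>M\<^esub> x) \<oplus>\<^bsub>Q\<^esub> (U +>\<^bsub>M\<^esub> y) = U +>\<^bsub>M\<^esub> (x \<oplus>\<^bsub>M\<^esub> y)"
  by (simp add: quotient_module_def U.a_rcos_sum)

lemma coset_eq_iff:
  assumes "x \<in> carrier M" "y \<in> carrier M"
  shows "U +>\<^bsub>M\<^esub> x = U +>\<^bsub>M\<^esub> y \<longleftrightarrow> (\<exists>u\<in>U. x = u \<oplus>\<^bsub>M\<^esub> y)"
proof
  assume "U +>\<^bsub>M\<^esub> x = U +>\<^bsub>M\<^esub> y"
  then have "x \<in> U +>\<^bsub>M\<^esub> y" using U.a_rcos_self[OF assms(1)] by simp
  then show "\<exists>u\<in>U. x = u \<oplus>\<^bsub>M\<^esub> y" by (auto simp: a_r_coset_def')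
next
  assume "\<exists>u\<in>U. x = u \<oplus>\<^bsub>M\<^esub> y"
  then have "x \<in> U +>\<^bsub>M\<^esub> y" by (auto simp: a_r_coset_def')
  then show "U +>\<^bsub>M\<^esub> x = U +>\<^bsub>M\<^esub> y" using U.a_repr_independence' assms(2) by blast
qed

lemma zero_Q: "\<zero>\<^bsub>Q\<^esub> = U +>\<^bsub>M\<^esub> \<zero>\<^bsub>M\<^esub>"
  using M.a_coset_add_zero[OF submoduleD(1)[OF U]] by (simp add: quotient_module_def)

lemma smult_Q:
  assumes a: "a \<in> carrier R" and x: "x \<in> carrier M"
  shows "a \<odot>\<^bsub>Q\<^esub> (U +>\<^bsub>M\<^esub> x) = U +>\<^bsub>M\<^esub> (a \<odot>\<^bsub>M\<^esub> x)"
proof -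
  have "U +>\<^bsub>M\<^esub> (a \<odot>\<^bsub>M\<^esub> y) = U +>\<^bsub>M\<^esub> (a \<odot>\<^bsub>M\<^esub> x)" if "y \<in> U +>\<^bsub>M\<^esub> x" for y
  proof -
    obtain u where u: "u \<in> U" "y = u \<oplus>\<^bsub>M\<^esub> x" using \<open>y \<in> U +>\<^bsub>M\<^esub> x\<close> by (auto simp: a_r_coset_def')
    then have "u \<in> carrier M" using submoduleD(1)[OF U] by blast
    then show ?thesis
      using submoduleD(4)[OF U a u(1)] a x u
      by (subst coset_eq_iff) (auto simp: smult_r_distr smult_closed)
  qed
  moreover have "x \<in> U +>\<^bsub>M\<^esub> x" using U.a_rcos_self[OF x] .
  moreover have "a \<odot>\<^bsub>Q\<^esub> (U +>\<^bsub>M\<^esub> x) = (\<Union>y\<in>U +>\<^bsub>M\<^esub> x. U +>\<^bsub>M\<^esub> (a \<odot>\<^bsub>M\<^esub> y))"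
    by (simp add: quotient_module_def)
  ultimately show ?thesis by blast
qed

theorem quotient_left_module: "left_module R Q"
proof -
  have "comm_group (add_monoid M Mod U)"
    by (rule comm_group.abelian_FactGroup[OF M.a_comm_group U_subgroup])
  then have "comm_group \<lparr>carrier = carrier Q, monoid.mult = add Q, one = \<zero>\<^bsub>Q\<^esub>\<rparr>"
    by (simp add: quotient_module_def FactGroup_def A_RCOSETS_def set_add_def)
  then interpret Q: abelian_group Q by (rule abelian_group_of_truncation)
  have "left_module_axioms R Q"
    by unfold_locales
      (auto simp: carrier_Q smult_Q add_Q smult_closed smult_l_distr smult_r_distr smult_assoc smult_one)
  then show ?thesis by (intro left_module.intro R.ring_axioms Q.abelian_group_axioms)
qed

end

section \<open>Induced modules\<close>

locale tensor_induction = R: ring R + L: left_module S L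
  for R :: "'a ring" and S :: "'a ring" and L :: "('a, 'b) module" +
  assumes sub: "carrier S \<subseteq> carrier R"
begin

abbreviation F where "F \<equiv> free_Abelian_group (carrier R \<times> carrier L)"
abbreviation K where "K \<equiv> generate F (tensor_relations R S L)"
abbreviation M where "M \<equiv> induced_module R S L"

definition coset_of where "coset_of c = K #>\<^bsub>F\<^esub> c"

text \<open>
  Left multiplication on the first tensor factor, before passing to the quotient.
\<close>

definition lmult where "lmult r = frag_extend (\<lambda>(a, x). frag_of (r \<otimes>\<^bsub>R\<^esub> a, x))"

sublocale F: comm_group F
  by (rule abelian_free_Abelian_group)

lemma F_closed:
  "c \<in> carrier F \<Longrightarrow> d \<in> carrier F \<Longrightarrow> c + d \<in> carrier F"
  "c \<in> carrier F \<Longrightarrow> d \<in> carrier F \<Longrightarrow> c - d \<in> carrier F"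
  "c \<in> carrier F \<Longrightarrow> - c \<in> carrier F"
  using Poly_Mapping.keys_add[of c d] keys_diff[of c d] by auto

lemma tensor_relations_carrier: "tensor_relations R S L \<subseteq> carrier F"
proof
  fix r assume "r \<in> tensor_relations R S L"
  then show "r \<in> carrier F"
    by cases (use sub in \<open>auto simp del: carrier_free_Abelian_group_iff
        intro!: F_closed L.M.a_closed L.smult_closed\<close>)
qed

lemma K_subgroup: "subgroup K F"
  by (rule F.generate_is_subgroup[OF tensor_relations_carrier])

lemma K_carrier: "c \<in> K \<Longrightarrow> c \<in> carrier F"
  using subgroup.subset[OF K_subgroup] by blast

lemma K_closed: "0 \<in> K" "c \<in> K \<Longrightarrow> d \<in> K \<Longrightarrow> c + d \<in> K" "c \<in> K \<Longrightarrow> - c \<in> K"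
    "c \<in> K \<Longrightarrow> d \<in> K \<Longrightarrow> c - d \<in> K"
proof -
  show "0 \<in> K" using subgroup.one_closed[OF K_subgroup] by simp
  show add: "c \<in> K \<Longrightarrow> d \<in> K \<Longrightarrow> c + d \<in> K" for c d
    using subgroup.m_closed[OF K_subgroup] by simp
  show neg: "c \<in> K \<Longrightarrow> - c \<in> K" for c
    using subgroup.m_inv_closed[OF K_subgroup, of c] K_carrier[of c] by simp
  show "c \<in> K \<Longrightarrow> d \<in> K \<Longrightarrow> c - d \<in> K"
    using add[OF _ neg] by fastforce
qed

lemma carrier_M: "carrier M = coset_of ` carrier F"
  by (simp add: induced_module_def Let_def carrier_FactGroup coset_of_def)

lemma zero_M: "\<zero>\<^bsub>M\<^esub> = coset_of 0"
  using F.coset_mult_one[of K] K_subgroup[THEN subgroup.subset]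
  by (simp add: induced_module_def Let_def coset_of_def)

lemma add_M: "c \<in> carrier F \<Longrightarrow> d \<in> carrier F \<Longrightarrow> coset_of c \<oplus>\<^bsub>M\<^esub> coset_of d = coset_of (c + d)"
  using normal.rcos_sum[OF F.subgroup_imp_normal[OF K_subgroup], of c d]
  by (simp add: induced_module_def Let_def coset_of_def)

lemma coset_of_eq_iff:
  assumes "c \<in> carrier F" "d \<in> carrier F"
  shows "coset_of c = coset_of d \<longleftrightarrow> c - d \<in> K"
proof -
  have mem: "x \<in> coset_of y \<longleftrightarrow> x - y \<in> K" for x y
    by (auto simp: coset_of_def r_coset_def intro!: bexI[of _ "x - y"])
  show ?thesis
  proof
    assume "coset_of c = coset_of d"
    moreover have "c \<in> coset_of c" by (simp add: mem K_closed)
    ultimately show "c - d \<in> K" by (simp add: mem)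
  next
    assume cd: "c - d \<in> K"
    have "x - c \<in> K \<longleftrightarrow> x - d \<in> K" for x
      using K_closed(2)[OF _ cd, of "x - c"] K_closed(4)[OF _ cd, of "x - d"] by auto
    then show "coset_of c = coset_of d" by (auto simp: mem)
  qed
qed

lemma lmult_simps [simp]: "lmult r 0 = 0" "lmult r (c + d) = lmult r c + lmult r d"
  "lmult r (c - d) = lmult r c - lmult r d" "lmult r (- c) = - lmult r c"
  "lmult r (frag_of (a, x)) = frag_of (r \<otimes>\<^bsub>R\<^esub> a, x)"
  by (simp_all add: lmult_def frag_extend_add frag_extend_diff frag_extend_minus)

lemma F_induct [consumes 1, case_names one diff of]:
  assumes "c \<in> carrier F" "P 0"
    "\<And>c d. c \<in> carrier F \<Longrightarrow> d \<in> carrier F \<Longrightarrow> P c \<Longrightarrow> P d \<Longrightarrow> P (c - d)"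
    "\<And>a x. a \<in> carrier R \<Longrightarrow> x \<in> carrier L \<Longrightarrow> P (frag_of (a, x))"
  shows "P c"
proof -
  have "c \<in> carrier F \<and> P c"
    by (rule frag_induction[of c "carrier R \<times> carrier L"])
      (use assms F_closed in auto)
  then show ?thesis by simp
qed

lemma lmult_closed:
  assumes "r \<in> carrier R" "c \<in> carrier F"
  shows "lmult r c \<in> carrier F"
  using assms(2)
proof (induction rule: F_induct)
  case (diff c d)
  then show ?case unfolding lmult_simps by (intro F_closed)
qed (use assms in auto)

lemma lmult_K:
  assumes r: "r \<in> carrier R" and c: "c \<in> K"
  shows "lmult r c \<in> K"
  using c
proof (induction rule: generate.induct)
  case one
  then show ?case by (simp add: K_closed)
next
  have rel: "lmult r h \<in> K" if "h \<in> tensor_relations R S L" for h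
    using that
  proof cases
    case (add_left a b x)
    show ?thesis unfolding add_left lmult_simps using add_left r
      by (auto simp: R.r_distr intro!: generate.incl tensor_relations.add_left)
  next
    case (add_right a x y)
    show ?thesis unfolding add_right lmult_simps using add_right r
      by (auto intro!: generate.incl tensor_relations.add_right)
  next
    case (balanced a s x)
    then have "r \<otimes>\<^bsub>R\<^esub> (a \<otimes>\<^bsub>R\<^esub> s) = (r \<otimes>\<^bsub>R\<^esub> a) \<otimes>\<^bsub>R\<^esub> s"
      using r sub by (auto simp: R.m_assoc)
    then show ?thesis unfolding balanced lmult_simps using balanced r
      by (auto intro!: generate.incl tensor_relations.balanced)
  qed
  {
    case (incl h)
    then show ?case by (rule rel)
  next
    case (inv h)
    then have "h \<in> carrier F" using tensor_relations_carrier by blast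
    then have "inv\<^bsub>F\<^esub> h = - h" by simp
    then show ?case using rel[OF inv] by (simp add: K_closed)
  }
next
  case (eng h1 h2)
  then show ?case by (simp add: K_closed)
qed

lemma smult_M:
  assumes r: "r \<in> carrier R" and c: "c \<in> carrier F"
  shows "r \<odot>\<^bsub>M\<^esub> coset_of c = coset_of (lmult r c)"
proof -
  have "r \<odot>\<^bsub>M\<^esub> coset_of c = (\<Union>d\<in>coset_of c. coset_of (lmult r d))"
    by (simp add: induced_module_def Let_def coset_of_def lmult_def)
  moreover have "coset_of (lmult r d) = coset_of (lmult r c)" if d: "d \<in> coset_of c" for d
  proof -
    obtain k where k: "k \<in> K" "d = k + c" using d by (auto simp: coset_of_def r_coset_def)
    then have "d \<in> carrier F" using K_carrier c F_closed by blast
    moreover have "lmult r d - lmult r c = lmult r k" by (simp add: k(2))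
    ultimately show ?thesis
      using coset_of_eq_iff[OF lmult_closed lmult_closed] lmult_K[OF r k(1)] r c by simp
  qed
  moreover have "c \<in> coset_of c"
    using K_closed(1) by (force simp: coset_of_def r_coset_def)
  ultimately show ?thesis by blast
qed

lemma lmult_add_left:
  assumes "r \<in> carrier R" "s \<in> carrier R" "c \<in> carrier F"
  shows "lmult (r \<oplus>\<^bsub>R\<^esub> s) c - (lmult r c + lmult s c) \<in> K"
  using assms(3)
proof (induction rule: F_induct)
  case one
  then show ?case by (simp add: K_closed)
next
  case (diff c d)
  from K_closed(4)[OF diff(3,4)] show ?case by (simp add: algebra_simps)
next
  case (of a x)
  then show ?case using assms
    by (auto simp: R.l_distr intro!: generate.incl tensor_relations.add_left)
qed

lemma lmult_mult:
  assumes "r \<in> carrier R" "s \<in> carrier R" "c \<in> carrier F"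
  shows "lmult (r \<otimes>\<^bsub>R\<^esub> s) c = lmult r (lmult s c)"
  using assms(3) by (induction rule: F_induct) (use assms in \<open>simp_all add: R.m_assoc\<close>)

lemma lmult_one: "c \<in> carrier F \<Longrightarrow> lmult \<one>\<^bsub>R\<^esub> c = c"
  by (induction rule: F_induct) simp_all

theorem induced_left_module: "left_module R M"
proof -
  have "comm_group (F Mod K)" by (rule F.abelian_FactGroup[OF K_subgroup])
  then have "comm_group \<lparr>carrier = carrier M, monoid.mult = add M, one = \<zero>\<^bsub>M\<^esub>\<rparr>"
    by (simp add: induced_module_def Let_def FactGroup_def)
  then have "abelian_group M" by (rule abelian_group_of_truncation)
  then interpret M: abelian_group M .
  note [simp del] = carrier_free_Abelian_group_iff
  note [simp] = smult_M lmult_closed add_M F_closed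
  have rep: "\<exists>c\<in>carrier F. x = coset_of c" if "x \<in> carrier M" for x
    using that by (auto simp: carrier_M)
  have "left_module_axioms R M"
  proof
    show "a \<odot>\<^bsub>M\<^esub> x \<in> carrier M" if "a \<in> carrier R" "x \<in> carrier M" for a x
      using that by (auto simp: carrier_M)
    show "a \<odot>\<^bsub>M\<^esub> (x \<oplus>\<^bsub>M\<^esub> y) = a \<odot>\<^bsub>M\<^esub> x \<oplus>\<^bsub>M\<^esub> a \<odot>\<^bsub>M\<^esub> y"
      if "a \<in> carrier R" "x \<in> carrier M" "y \<in> carrier M" for a x y
      using that by (auto dest!: rep)
    show "(a \<oplus>\<^bsub>R\<^esub> b) \<odot>\<^bsub>M\<^esub> x = a \<odot>\<^bsub>M\<^esub> x \<oplus>\<^bsub>M\<^esub> b \<odot>\<^bsub>M\<^esub> x"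
      if "a \<in> carrier R" "b \<in> carrier R" "x \<in> carrier M" for a b x
      using rep[OF that(3)] that(1,2) by (elim bexE) (simp add: coset_of_eq_iff lmult_add_left)
    show "(a \<otimes>\<^bsub>R\<^esub> b) \<odot>\<^bsub>M\<^esub> x = a \<odot>\<^bsub>M\<^esub> (b \<odot>\<^bsub>M\<^esub> x)"
      if "a \<in> carrier R" "b \<in> carrier R" "x \<in> carrier M" for a b x
      using that by (auto dest!: rep simp: lmult_mult)
    show "\<one>\<^bsub>R\<^esub> \<odot>\<^bsub>M\<^esub> x = x" if "x \<in> carrier M" for x
      using that by (auto dest!: rep simp: lmult_one)
  qed
  then show ?thesis
    by (intro left_module.intro R.ring_axioms M.abelian_group_axioms)
qed

definition tensor where "tensor a x = coset_of (frag_of (a, x))"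

text \<open>
  If \<open>x = sv\<close> then \<open>a \<otimes> x = as \<otimes> v\<close>, so a module induced from a cyclic module is cyclic.
\<close>

lemma induced_cyclic:
  assumes v: "v \<in> carrier L" and L: "\<And>x. x \<in> carrier L \<Longrightarrow> \<exists>s\<in>carrier S. x = s \<odot>\<^bsub>L\<^esub> v"
    and m: "m \<in> carrier M"
  shows "\<exists>r\<in>carrier R. m = r \<odot>\<^bsub>M\<^esub> tensor \<one>\<^bsub>R\<^esub> v"
proof -
  have u: "frag_of (\<one>\<^bsub>R\<^esub>, v) \<in> carrier F" using v by simp
  have "\<exists>r\<in>carrier R. coset_of c = coset_of (frag_of (r, v))" if "c \<in> carrier F" for c
    using that
  proof (induction rule: F_induct)
    case one
    have "frag_of (\<zero>\<^bsub>R\<^esub> \<oplus>\<^bsub>R\<^esub> \<zero>\<^bsub>R\<^esub>, v) - (frag_of (\<zero>\<^bsub>R\<^esub>, v) + frag_of (\<zero>\<^bsub>R\<^esub>, v)) \<in> K"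
      using v by (intro generate.incl tensor_relations.add_left) auto
    then have "coset_of 0 = coset_of (frag_of (\<zero>\<^bsub>R\<^esub>, v))" using v by (subst coset_of_eq_iff) auto
    then show ?case by blast
  next
    case (diff c d)
    then obtain r s where rs: "r \<in> carrier R" "coset_of c = coset_of (frag_of (r, v))"
      "s \<in> carrier R" "coset_of d = coset_of (frag_of (s, v))" by auto
    have F: "frag_of (r, v) \<in> carrier F" "frag_of (s, v) \<in> carrier F"
      "frag_of (r \<ominus>\<^bsub>R\<^esub> s, v) \<in> carrier F" using rs v by auto
    have "frag_of ((r \<ominus>\<^bsub>R\<^esub> s) \<oplus>\<^bsub>R\<^esub> s, v) - (frag_of (r \<ominus>\<^bsub>R\<^esub> s, v) + frag_of (s, v)) \<in> K"
      using v rs by (intro generate.incl tensor_relations.add_left) auto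
    moreover have "(r \<ominus>\<^bsub>R\<^esub> s) \<oplus>\<^bsub>R\<^esub> s = r"
      using rs by (simp add: a_minus_def R.a_assoc R.l_neg)
    ultimately have 1: "frag_of (r, v) - frag_of (s, v) - frag_of (r \<ominus>\<^bsub>R\<^esub> s, v) \<in> K"
      by (simp add: algebra_simps)
    have 2: "c - frag_of (r, v) \<in> K" "d - frag_of (s, v) \<in> K"
      using rs F diff by (simp_all only: coset_of_eq_iff)
    have "(c - d) - frag_of (r \<ominus>\<^bsub>R\<^esub> s, v) \<in> K"
      using K_closed(2)[OF K_closed(4)[OF 2] 1] by (simp add: algebra_simps)
    then have "coset_of (c - d) = coset_of (frag_of (r \<ominus>\<^bsub>R\<^esub> s, v))"
      using coset_of_eq_iff[OF F_closed(2)[OF diff(1,2)] F(3)] by simp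
    then show ?case using rs by blast
  next
    case (of a x)
    then obtain s where s: "s \<in> carrier S" "x = s \<odot>\<^bsub>L\<^esub> v" using L by blast
    have "frag_of (a \<otimes>\<^bsub>R\<^esub> s, v) - frag_of (a, s \<odot>\<^bsub>L\<^esub> v) \<in> K"
      using of s v by (intro generate.incl tensor_relations.balanced) auto
    then have "coset_of (frag_of (a \<otimes>\<^bsub>R\<^esub> s, v)) = coset_of (frag_of (a, x))"
      using of s v sub by (subst coset_of_eq_iff) auto
    then show ?case using of s sub by (metis R.m_closed subsetD)
  qed
  then show ?thesis
    using m u by (force simp: carrier_M tensor_def smult_M simp del: carrier_free_Abelian_group_iff)
qed

lemma tensor_closed: "a \<in> carrier R \<Longrightarrow> x \<in> carrier L \<Longrightarrow> tensor a x \<in> carrier M"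
  by (auto simp: tensor_def carrier_M)

lemma smult_tensor:
  "r \<in> carrier R \<Longrightarrow> a \<in> carrier R \<Longrightarrow> x \<in> carrier L \<Longrightarrow> r \<odot>\<^bsub>M\<^esub> tensor a x = tensor (r \<otimes>\<^bsub>R\<^esub> a) x"
  unfolding tensor_def by (subst smult_M) auto

lemma smult_tensor_right:
  "a \<in> carrier R \<Longrightarrow> s \<in> carrier S \<Longrightarrow> x \<in> carrier L \<Longrightarrow> tensor (a \<otimes>\<^bsub>R\<^esub> s) x = tensor a (s \<odot>\<^bsub>L\<^esub> x)"
  unfolding tensor_def using sub
  by (subst coset_of_eq_iff) (auto intro!: generate.incl tensor_relations.balanced L.smult_closed)

text \<open>
  This consequence of the universal property is the tool for showing that the induced module is not
  too small.
\<close>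

lemma tensor_universal:
  fixes \<phi> :: "'a \<Rightarrow> 'b \<Rightarrow> 'v :: ab_group_add"
  assumes add_left: "\<And>a b x. a \<in> carrier R \<Longrightarrow> b \<in> carrier R \<Longrightarrow> x \<in> carrier L \<Longrightarrow>
      \<phi> (a \<oplus>\<^bsub>R\<^esub> b) x = \<phi> a x + \<phi> b x"
    and add_right: "\<And>a x y. a \<in> carrier R \<Longrightarrow> x \<in> carrier L \<Longrightarrow> y \<in> carrier L \<Longrightarrow>
      \<phi> a (x \<oplus>\<^bsub>L\<^esub> y) = \<phi> a x + \<phi> a y"
    and balanced: "\<And>a s x. a \<in> carrier R \<Longrightarrow> s \<in> carrier S \<Longrightarrow> x \<in> carrier L \<Longrightarrow>
      \<phi> (a \<otimes>\<^bsub>R\<^esub> s) x = \<phi> a (s \<odot>\<^bsub>L\<^esub> x)"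
    and a: "a \<in> carrier R" and x: "x \<in> carrier L" and zero: "tensor a x = \<zero>\<^bsub>M\<^esub>"
  shows "\<phi> a x = 0"
proof -
  define G :: "'v monoid" where "G = \<lparr>carrier = UNIV, monoid.mult = (+), one = 0\<rparr>"
  interpret G: comm_group G
    by (rule comm_groupI) (auto simp: G_def add_ac intro: exI[of _ "- _"] left_minus)
  obtain h where h: "h \<in> hom F G"
    and h_of: "\<And>p. p \<in> carrier R \<times> carrier L \<Longrightarrow> h (frag_of p) = case_prod \<phi> p"
    using G.free_Abelian_group_universal[of "case_prod \<phi>" "carrier R \<times> carrier L"] by (auto simp: G_def)
  interpret h: group_hom F G h
    using h by (simp add: group_hom_def group_hom_axioms_def)
  have h_add: "h (c + d) = h c + h d" if "c \<in> carrier F" "d \<in> carrier F" for c d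
    using h.hom_mult[OF that] by (simp add: G_def)
  have h_zero: "h 0 = 0" using h.hom_one by (simp add: G_def)
  have h_diff: "h (c - d) = h c - h d" if "c \<in> carrier F" "d \<in> carrier F" for c d
    using h_add[OF F_closed(2)[OF that] that(2)] by simp
  have rel: "h c = 0" if "c \<in> tensor_relations R S L" for c
    using that
  proof cases
    case (add_left a b x)
    then show ?thesis by (auto simp: h_diff h_add h_of assms F_closed simp del: carrier_free_Abelian_group_iff)
  next
    case (add_right a x y)
    then show ?thesis by (auto simp: h_diff h_add h_of assms F_closed simp del: carrier_free_Abelian_group_iff)
  next
    case (balanced a s x)
    then show ?thesis using sub L.smult_closed
      by (auto simp: h_diff h_add h_of assms F_closed simp del: carrier_free_Abelian_group_iff)
  qed
  have K: "h c = 0" if "c \<in> K" for c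
    using that
  proof (induction rule: generate.induct)
    case one
    then show ?case by (simp add: h_zero)
  next
    case (incl c)
    then show ?case by (rule rel)
  next
    case (inv c)
    then have "c \<in> carrier F" using tensor_relations_carrier by blast
    moreover from this have "inv\<^bsub>F\<^esub> c = 0 - c" by simp
    ultimately show ?case
      using h_diff[of 0 c] rel[OF inv] by (simp add: h_zero)
  next
    case (eng c d)
    then show ?case using K_carrier by (simp add: h_add del: carrier_free_Abelian_group_iff)
  qed
  have "frag_of (a, x) - 0 \<in> K"
    using zero a x unfolding tensor_def zero_M by (subst (asm) coset_of_eq_iff) auto
  then show ?thesis using K[of "frag_of (a, x)"] h_of[of "(a, x)"] a x by simp
qed

end

section \<open>The Hecke algebra as a quotient of the free algebra\<close>

lemma free_ring_simps [simp]:
  "carrier free_ring = UNIV" "x \<otimes>\<^bsub>free_ring\<^esub> y = x * y" "\<one>\<^bsub>free_ring\<^esub> = 1"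
  "\<zero>\<^bsub>free_ring\<^esub> = 0" "x \<oplus>\<^bsub>free_ring\<^esub> y = x + y"
  by (simp_all add: free_ring_def)

interpretation free: ring free_ring
  by (rule ringI; (rule abelian_groupI monoidI)?)
    (auto simp: algebra_simps intro: exI[of _ "- _"] left_minus)

lemma free_minus [simp]: "\<ominus>\<^bsub>free_ring\<^esub> x = - x" "x \<ominus>\<^bsub>free_ring\<^esub> y = x - y"
proof -
  show "\<ominus>\<^bsub>free_ring\<^esub> x = - x" for x by (rule free.minus_equality) auto
  then show "x \<ominus>\<^bsub>free_ring\<^esub> y = x - y" by (simp add: a_minus_def)
qed

definition hecke_class :: "complex \<Rightarrow> free_algebra \<Rightarrow> free_algebra set" where
  "hecke_class q f = hecke_ideal q +>\<^bsub>free_ring\<^esub> f"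

lemma ideal_hecke_ideal: "ideal (hecke_ideal q) free_ring"
  unfolding hecke_ideal_def by (rule free.genideal_ideal) simp

interpretation hecke: ring "hecke q" for q
  unfolding hecke_def by (rule ideal.quotient_is_ring[OF ideal_hecke_ideal])

lemma hecke_relations_subset: "r \<in> hecke_relations q \<Longrightarrow> r \<in> hecke_ideal q"
  unfolding hecke_ideal_def using free.genideal_self[of "hecke_relations q"] by auto

lemma hecke_class_generators:
  "hscal q c = hecke_class q (fscal c)" "hT q i = hecke_class q (fT i)"
  "hX q l = hecke_class q (fX l)"
  by (simp_all add: hscal_def hT_def hX_def hecke_class_def)

lemma carrier_hecke: "carrier (hecke q) = range (hecke_class q)"
  by (auto simp: hecke_def FactRing_def A_RCOSETS_def' hecke_class_def)

lemma hecke_class_closed [simp]: "hecke_class q f \<in> carrier (hecke q)"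
  by (simp add: carrier_hecke)

lemma abelian_subgroup_hecke_ideal: "abelian_subgroup (hecke_ideal q) free_ring"
  by (rule abelian_subgroupI3[OF ideal.axioms(1)[OF ideal_hecke_ideal] free.abelian_group_axioms])

lemma hecke_class_add: "hecke_class q f \<oplus>\<^bsub>hecke q\<^esub> hecke_class q g = hecke_class q (f + g)"
  using abelian_subgroup.a_rcos_sum[OF abelian_subgroup_hecke_ideal, of f g q] by (simp add: hecke_def FactRing_def hecke_class_def)

lemma hecke_class_mult: "hecke_class q f \<otimes>\<^bsub>hecke q\<^esub> hecke_class q g = hecke_class q (f * g)"
  using ideal.rcoset_mult_add[OF ideal_hecke_ideal, of f g q] by (simp add: hecke_def FactRing_def hecke_class_def)

lemma hecke_class_one: "\<one>\<^bsub>hecke q\<^esub> = hecke_class q 1"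
  by (simp add: hecke_def FactRing_def hecke_class_def)

lemma hecke_class_zero: "\<zero>\<^bsub>hecke q\<^esub> = hecke_class q 0"
  using free.a_coset_add_zero[of "hecke_ideal q"] by (simp add: hecke_def FactRing_def hecke_class_def)

lemma hecke_class_eq_iff: "hecke_class q f = hecke_class q g \<longleftrightarrow> f - g \<in> hecke_ideal q"
  using free.quotient_eq_iff_same_a_r_cos[OF ideal_hecke_ideal, of f g q]
  by (simp add: hecke_class_def)

lemma hecke_class_uminus: "\<ominus>\<^bsub>hecke q\<^esub> hecke_class q f = hecke_class q (- f)"
  by (rule hecke.minus_equality) (simp_all add: hecke_class_add hecke_class_zero)

text \<open>
  The elements that act by zero on the model form a two-sided ideal that contains the relations.
\<close>

lemma (in hecke_parameter) act_hecke_ideal: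
  assumes "f \<in> hecke_ideal q" shows "act q f x = 0"
proof -
  let ?I = "{f. \<forall>x. act q f x = 0}"
  note [simp del] = split_paired_All
  have "ideal ?I free_ring"
  proof (rule idealI)
    show "subgroup ?I (add_monoid free_ring)"
      by (rule free.add.subgroupI) (auto simp: word_rep.act_plus word_rep.act_uminus intro: exI[of _ 0])
  qed (auto simp: word_rep.act_mult word_rep.act_zero_right free.ring_axioms)
  then have "hecke_ideal q \<subseteq> ?I"
    unfolding hecke_ideal_def
    by (rule free.genideal_minimal) (auto simp: act_hecke_relations)
  then show ?thesis using assms by blast
qed

section \<open>Equivariant maps\<close>

text \<open>
  All modules to be studied are images of the model \<open>\<complex>\<^sup>6\<close> under equivariant maps: the induced module, its
  quotient and the iterated quotient. Their submodules can therefore be described by invariant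
  subspaces of one fixed space.
\<close>

locale equivariant = hecke_parameter q + Q: left_module "hecke q" Q
  for q and Q :: "(free_algebra set, 'b) module" +
  fixes g :: "vec \<Rightarrow> 'b"
  assumes g_closed: "g x \<in> carrier Q"
    and g_add: "g (x + y) = g x \<oplus>\<^bsub>Q\<^esub> g y"
    and g_act: "g (act q f x) = hecke_class q f \<odot>\<^bsub>Q\<^esub> g x"

definition invariant :: "complex \<Rightarrow> vec set \<Rightarrow> bool" where
  "invariant q W \<longleftrightarrow> 0 \<in> W \<and> (\<forall>x\<in>W. \<forall>y\<in>W. x + y \<in> W) \<and> (\<forall>x\<in>W. \<forall>f. act q f x \<in> W)"

lemma invariantI:
  assumes zero: "0 \<in> W" and add: "\<And>x y. x \<in> W \<Longrightarrow> y \<in> W \<Longrightarrow> x + y \<in> W"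
    and scale: "\<And>c x. x \<in> W \<Longrightarrow> scl c x \<in> W"
    and T: "\<And>i x. x \<in> W \<Longrightarrow> opT q i x \<in> W" and X: "\<And>l x. x \<in> W \<Longrightarrow> opX q l x \<in> W"
  shows "invariant q W"
proof -
  have "act q f x \<in> W" if "x \<in> W" for f x
    by (induction f rule: free_algebra_induct)
      (simp_all add: that word_rep.act_plus word_rep.act_mult assms)
  then show ?thesis using assms by (auto simp: invariant_def)
qed

lemma invariantD:
  assumes "invariant q W"
  shows "0 \<in> W" "x \<in> W \<Longrightarrow> y \<in> W \<Longrightarrow> x + y \<in> W" "x \<in> W \<Longrightarrow> act q f x \<in> W"
    "x \<in> W \<Longrightarrow> scl c x \<in> W" "x \<in> W \<Longrightarrow> opT q i x \<in> W" "x \<in> W \<Longrightarrow> opX q l x \<in> W"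
  using assms unfolding invariant_def by (metis act_fscal act_fT act_fX)+

context equivariant
begin

lemma g_zero: "g 0 = \<zero>\<^bsub>Q\<^esub>"
  using g_add[of 0 0] g_closed[of 0] by (simp add: Q.M.add.l_cancel_one')

lemma g_minus_eq_zero_iff: "g (x - y) = \<zero>\<^bsub>Q\<^esub> \<longleftrightarrow> g x = g y"
  using g_add[of "x - y" y] g_closed[of "x - y"] g_closed[of x] g_closed[of y]
  by (auto simp: Q.M.add.l_cancel_one)

lemma image_submodule:
  assumes "invariant q W" shows "submodule (g ` W) (hecke q) Q"
proof (rule Q.submoduleI)
  show "g ` W \<subseteq> carrier Q" using g_closed by auto
  show "\<zero>\<^bsub>Q\<^esub> \<in> g ` W" using invariantD(1)[OF assms] g_zero by force
  show "x \<oplus>\<^bsub>Q\<^esub> y \<in> g ` W" if "x \<in> g ` W" "y \<in> g ` W" for x y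
    using that invariantD(2)[OF assms] by (auto simp flip: g_add)
  show "a \<odot>\<^bsub>Q\<^esub> x \<in> g ` W" if "a \<in> carrier (hecke q)" "x \<in> g ` W" for a x
    using that invariantD(3)[OF assms] by (auto simp: carrier_hecke simp flip: g_act)
qed

lemma restrict_equivariant_submodule:
  assumes W0: "invariant q W0" and W: "invariant q W" and sub: "W \<subseteq> W0"
  shows "submodule (g ` W) (hecke q) (Q\<lparr>carrier := g ` W0\<rparr>)"
proof -
  interpret Q0: left_module "hecke q" "Q\<lparr>carrier := g ` W0\<rparr>"
    by (rule Q.restrict_left_module[OF image_submodule[OF W0]])
  show ?thesis
    using Q.submoduleD[OF image_submodule[OF W]] sub by (intro Q0.submoduleI) auto
qed

text \<open>
  Submodules of the image of \<open>W0\<close> correspond to invariant subspaces between the kernel and \<open>W0\<close>. The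
  image is irreducible if an invariant subspace that is strictly larger than the kernel is already
  everything.
\<close>

lemma irreducible_image:
  assumes W0: "invariant q W0" and proper: "\<exists>x\<in>W0. g x \<noteq> \<zero>\<^bsub>Q\<^esub>"
    and max: "\<And>W x. invariant q W \<Longrightarrow> W \<subseteq> W0 \<Longrightarrow> {x \<in> W0. g x = \<zero>\<^bsub>Q\<^esub>} \<subseteq> W \<Longrightarrow>
      x \<in> W \<Longrightarrow> g x \<noteq> \<zero>\<^bsub>Q\<^esub> \<Longrightarrow> W0 \<subseteq> W"
  shows "irreducible_module (hecke q) (Q\<lparr>carrier := g ` W0\<rparr>)"
proof -
  interpret Q0: left_module "hecke q" "Q\<lparr>carrier := g ` W0\<rparr>"
    by (rule Q.restrict_left_module[OF image_submodule[OF W0]])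
  have "U = {\<zero>\<^bsub>Q\<^esub>} \<or> U = g ` W0" if "submodule U (hecke q) (Q\<lparr>carrier := g ` W0\<rparr>)" for U
  proof -
    note U = Q0.submoduleD[OF that, simplified]
    define W where "W = {x \<in> W0. g x \<in> U}"
    have inv: "invariant q W"
      unfolding invariant_def using invariantD[OF W0] U by (auto simp: W_def g_add g_act g_zero)
    have im: "g ` W = U" using U(1) by (auto simp: W_def)
    have ker: "{x \<in> W0. g x = \<zero>\<^bsub>Q\<^esub>} \<subseteq> W" using U(2) by (auto simp: W_def)
    show ?thesis
    proof (cases "\<exists>x\<in>W. g x \<noteq> \<zero>\<^bsub>Q\<^esub>")
      case True
      then have "W0 \<subseteq> W" using max[OF inv _ ker] W_def by blast
      then have "W = W0" by (auto simp: W_def)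
      then show ?thesis using im by simp
    next
      case False
      then show ?thesis using im U(2) by auto
    qed
  qed
  moreover have "g ` W0 \<noteq> {\<zero>\<^bsub>Q\<^esub>}" using proper by auto
  ultimately show ?thesis
    by unfold_locales auto
qed

text \<open>
  The kernel of \<open>g\<close> enters: a vector needs to satisfy the weight condition only modulo the kernel to
  give a weight vector in the image.
\<close>

lemma weight_space_image:
  assumes W0: "invariant q W0"
  shows "weight_space q (Q\<lparr>carrier := g ` W0\<rparr>) \<tau>
    = g ` {x \<in> W0. \<forall>l. g (opX q l x - scl (\<tau> l) x) = \<zero>\<^bsub>Q\<^esub>}"
proof -
  have "hX q l \<odot>\<^bsub>Q\<^esub> g x = hscal q (\<tau> l) \<odot>\<^bsub>Q\<^esub> g x \<longleftrightarrow> g (opX q l x - scl (\<tau> l) x) = \<zero>\<^bsub>Q\<^esub>" for x l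
    by (simp add: g_minus_eq_zero_iff hecke_class_generators flip: g_act)
  then show ?thesis by (auto simp: weight_space_def)
qed

lemma quotient_equivariant:
  assumes "invariant q W"
  shows "equivariant q (quotient_module Q (g ` W)) (\<lambda>x. g ` W +>\<^bsub>Q\<^esub> g x)"
proof -
  interpret quot: module_quotient "hecke q" Q "g ` W"
    by (intro module_quotient.intro module_quotient_axioms.intro Q.left_module_axioms image_submodule assms)
  have "equivariant_axioms q quot.Q (\<lambda>x. g ` W +>\<^bsub>Q\<^esub> g x)"
    by unfold_locales (auto simp: quot.carrier_Q quot.add_Q quot.smult_Q g_closed g_add g_act)
  then show ?thesis
    by (intro equivariant.intro hecke_parameter_axioms quot.quotient_left_module)
qed

lemma quotient_kernel:
  assumes W: "invariant q W" and ker: "\<And>x. g x = \<zero>\<^bsub>Q\<^esub> \<Longrightarrow> x \<in> W"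
  shows "g ` W +>\<^bsub>Q\<^esub> g x = \<zero>\<^bsub>quotient_module Q (g ` W)\<^esub> \<longleftrightarrow> x \<in> W"
proof -
  interpret quot: module_quotient "hecke q" Q "g ` W"
    by (intro module_quotient.intro module_quotient_axioms.intro Q.left_module_axioms image_submodule assms)
  have "g ` W +>\<^bsub>Q\<^esub> g x = \<zero>\<^bsub>quotient_module Q (g ` W)\<^esub> \<longleftrightarrow> (\<exists>w\<in>W. g x = g w)"
    unfolding quot.zero_Q
    by (subst quot.coset_eq_iff) (auto simp: g_closed)
  also have "\<dots> \<longleftrightarrow> x \<in> W"
  proof
    assume "\<exists>w\<in>W. g x = g w"
    then obtain w where w: "w \<in> W" "g (x - w) = \<zero>\<^bsub>Q\<^esub>" by (auto simp: g_minus_eq_zero_iff)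
    then have "(x - w) + w \<in> W" using ker invariantD(2)[OF W] by blast
    then show "x \<in> W" by simp
  qed auto
  finally show ?thesis .
qed

lemma quotient_surj:
  assumes W: "invariant q W" and "range g = carrier Q"
  shows "range (\<lambda>x. g ` W +>\<^bsub>Q\<^esub> g x) = carrier (quotient_module Q (g ` W))"
proof -
  interpret quot: module_quotient "hecke q" Q "g ` W"
    by (intro module_quotient.intro module_quotient_axioms.intro Q.left_module_axioms image_submodule assms)
  show ?thesis by (auto simp: quot.carrier_Q simp flip: assms(2))
qed

end

section \<open>Invariant subspaces of the model\<close>

text \<open>
  The invariant flag in the model; the middle member is invariant only if \<open>q\<^sup>2\<close> is a primitive third
  root of unity. The functions \<open>wt4\<close>, \<open>wt5\<close> and \<open>wt6\<close> are the weights \<open>s\<^sub>1s\<^sub>2t\<close>, \<open>s\<^sub>2s\<^sub>1s\<^sub>2t\<close> and \<open>s\<^sub>1s\<^sub>2s\<^sub>1s\<^sub>2t\<close> of the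
  corresponding basis vectors.
\<close>

definition tail1 :: "vec set" where "tail1 = {(0, 0, 0, 0, 0, f) | f. True}"
definition tail2 :: "vec set" where "tail2 = {(0, 0, 0, 0, e, f) | e f. True}"
definition tail3 :: "vec set" where "tail3 = {(0, 0, 0, d, e, f) | d e f. True}"

definition wt4 :: "complex \<Rightarrow> lattice \<Rightarrow> complex" where
  "wt4 q l = q powi (4 * snd l - 2 * fst l)"
definition wt5 :: "complex \<Rightarrow> lattice \<Rightarrow> complex" where
  "wt5 q l = q powi (2 * fst l - 4 * snd l)"
definition wt6 :: "complex \<Rightarrow> lattice \<Rightarrow> complex" where
  "wt6 q l = q powi (2 * snd l - 2 * fst l)"

lemma invariant_combination:
  "invariant q W \<Longrightarrow> x \<in> W \<Longrightarrow> y \<in> W \<Longrightarrow> scl a x + scl b y \<in> W"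
  by (intro invariantD)

context hecke_parameter
begin

lemma invariant_tail1: "invariant q tail1"
proof (rule invariantI)
  show "opT q i x \<in> tail1" if "x \<in> tail1" for i x using that by (cases i) (auto simp: tail1_def)
qed (auto simp: tail1_def zero_vec)

lemma invariant_tail3: "invariant q tail3"
proof (rule invariantI)
  show "opT q i x \<in> tail3" if "x \<in> tail3" for i x using that by (cases i) (auto simp: tail3_def)
qed (auto simp: tail3_def zero_vec)

lemma invariant_tail2:
  assumes "q ^ 4 + q ^ 2 + 1 = 0" shows "invariant q tail2"
proof (rule invariantI)
  show "opT q i x \<in> tail2" if "x \<in> tail2" for i x
    using that assms by (cases i) (auto simp: tail2_def)
qed (auto simp: tail2_def zero_vec)

text \<open>
  These consequences of the hypotheses on \<open>q\<^sup>2\<close> separate the weights of the model by their values at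
  \<open>\<alpha>\<^sub>1\<close> and \<open>\<alpha>\<^sub>2\<close>.
\<close>

lemma weight_inequalities:
  "inverse q ^ 2 \<noteq> 1" "q ^ 2 \<noteq> inverse q ^ 2" "q ^ 4 \<noteq> q ^ 2" "inverse q ^ 4 \<noteq> inverse q ^ 2"
proof -
  have q4: "q ^ 4 = (q ^ 2) ^ 2" "inverse q ^ 4 = (inverse q ^ 2) ^ 2" by (simp_all flip: power_mult)
  have inv: "q ^ 2 * inverse q ^ 2 = 1" using q0 by (simp flip: power_mult_distrib)
  show v1: "inverse q ^ 2 \<noteq> 1" using inv q1 by auto
  show "q ^ 2 \<noteq> inverse q ^ 2" using inv q1 qm1 power2_eq_1_iff[of "q ^ 2"]
    by (metis power2_eq_square)
  show "q ^ 4 \<noteq> q ^ 2"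
    unfolding q4 using q0 q1 by (metis mult_cancel_left mult.right_neutral power2_eq_square power_not_zero)
  show "inverse q ^ 4 \<noteq> inverse q ^ 2"
    unfolding q4 using q0 v1
    by (metis mult_cancel_left mult.right_neutral power2_eq_square power_not_zero inverse_nonzero_iff_nonzero)
qed

lemma opX_simple:
  "opX q (1, 0) (a, b, c, d, e, f) = (a + 2 * (q - inverse q) * b, b, q ^ 2 * c,
     inverse q ^ 2 * d, q ^ 2 * e, inverse q ^ 2 * f)"
  "opX q (0, 1) (a, b, c, d, e, f) = (q ^ 2 * (a - 3 * (q - inverse q) * b), q ^ 2 * b,
     inverse q ^ 2 * c, q ^ 4 * d, inverse q ^ 4 * e, q ^ 2 * f)"
  by (simp_all add: power_int_minus power_inverse algebra_simps)

lemma weight_vectors: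
  "{x. \<forall>l. opX q l x = scl (wt6 q l) x} = tail1"
  "{x. \<forall>l. opX q l x = scl (wt5 q l) x} = {(0, 0, 0, 0, e, 0) | e. True}"
  "{x. \<forall>l. opX q l x = scl (wt4 q l) x} = {(0, 0, 0, d, 0, 0) | d. True}"
proof -
  have val: "wt6 q (1, 0) = inverse q ^ 2" "wt6 q (0, 1) = q ^ 2"
    "wt5 q (1, 0) = q ^ 2" "wt5 q (0, 1) = inverse q ^ 4"
    "wt4 q (1, 0) = inverse q ^ 2" "wt4 q (0, 1) = q ^ 4"
    by (simp_all add: wt4_def wt5_def wt6_def power_int_minus power_inverse)
  note ne = q1 weight_inequalities weight_inequalities(2)[symmetric]
    weight_inequalities(3)[symmetric] weight_inequalities(4)[symmetric]
  have gen: "opX q (1, 0) x = scl (\<tau> (1, 0)) x \<and> opX q (0, 1) x = scl (\<tau> (0, 1)) x"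
    if "\<forall>l. opX q l x = scl (\<tau> l) x" for x \<tau>
    using that by blast
  have 6: "x \<in> tail1" if "\<forall>l. opX q l x = scl (wt6 q l) x" for x
    using gen[OF that] ne by (cases x) (auto simp: opX_simple val tail1_def simp del: opX.simps)
  have 5: "x \<in> {(0, 0, 0, 0, e, 0) | e. True}" if "\<forall>l. opX q l x = scl (wt5 q l) x" for x
    using gen[OF that] ne by (cases x) (auto simp: opX_simple val simp del: opX.simps)
  have 4: "x \<in> {(0, 0, 0, d, 0, 0) | d. True}" if "\<forall>l. opX q l x = scl (wt4 q l) x" for x
    using gen[OF that] ne by (cases x) (auto simp: opX_simple val simp del: opX.simps)
  have "opX q l x = scl (wt6 q l) x" if "x \<in> tail1" for x l
    using that by (cases l) (auto simp: tail1_def wt6_def)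
  then show "{x. \<forall>l. opX q l x = scl (wt6 q l) x} = tail1" using 6 by blast
  have "opX q l (0, 0, 0, 0, e, 0) = scl (wt5 q l) (0, 0, 0, 0, e, 0)" for e l
    by (cases l) (simp add: wt5_def)
  then show "{x. \<forall>l. opX q l x = scl (wt5 q l) x} = {(0, 0, 0, 0, e, 0) | e. True}"
    using 5 by blast
  have "opX q l (0, 0, 0, d, 0, 0) = scl (wt4 q l) (0, 0, 0, d, 0, 0)" for d l
    by (cases l) (simp add: wt4_def)
  then show "{x. \<forall>l. opX q l x = scl (wt4 q l) x} = {(0, 0, 0, d, 0, 0) | d. True}"
    using 4 by blast
qed

text \<open>
  Already \<open>X\<^bsup>\<alpha>\<^sub>1\<^esup>\<close> distinguishes the fourth basis vector from the fifth, with eigenvalues \<open>q\<^sup>-\<^sup>2\<close> and \<open>q\<^sup>2\<close>.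
\<close>

lemma weight_vectors_mod_tail1:
  "{x \<in> tail3. \<forall>l. opX q l x - scl (wt5 q l) x \<in> tail1} = tail2"
proof -
  have "x \<in> tail2" if x: "x \<in> tail3" and "\<forall>l. opX q l x - scl (wt5 q l) x \<in> tail1" for x
  proof -
    have "opX q (1, 0) x - scl (wt5 q (1, 0)) x \<in> tail1" using that by blast
    moreover have "wt5 q (1, 0) = q ^ 2" by (simp add: wt5_def)
    ultimately show ?thesis
      using x weight_inequalities(2)
      by (auto simp: tail3_def tail2_def tail1_def opX_simple simp del: opX.simps)
  qed
  moreover have "x \<in> tail3" "opX q l x - scl (wt5 q l) x \<in> tail1" if "x \<in> tail2" for x l
    using that by (cases l; auto simp: tail3_def tail2_def tail1_def wt5_def zero_prod_def)+
  ultimately show ?thesis by blast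
qed

text \<open>
  Modulo \<open>tail3\<close>, a nonzero vector has coordinates \<open>(a, b, c)\<close>, and \<open>X\<^bsup>\<alpha>\<^sub>1\<^esup>\<close> acts with eigenvalues \<open>1, 1, q\<^sup>2\<close>,
  with one Jordan block for the eigenvalue \<open>1\<close>. Powers of \<open>X\<^bsup>\<alpha>\<^sub>1\<^esup> - 1\<close> extract \<open>e\<^sub>1\<close> or \<open>e\<^sub>3\<close>. From \<open>e\<^sub>3\<close> one
  returns to \<open>e\<^sub>1\<close> by \<open>T\<^sub>2\<close> because \<open>q + q\<^sup>-\<^sup>1 \<noteq> 0\<close>, and \<open>e\<^sub>1\<close> generates.
\<close>

lemma tail3_maximal:
  assumes W: "invariant q W" and sub: "tail3 \<subseteq> W" and x: "x \<in> W" "x \<notin> tail3"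
  shows "W = UNIV"
proof -
  note comb = invariant_combination[OF W]
  define u1 u2 u3 :: vec where "u1 = (1, 0, 0, 0, 0, 0)" and "u2 = (0, 1, 0, 0, 0, 0)"
    and "u3 = (0, 0, 1, 0, 0, 0)"
  obtain a b c d e f where xe: "x = (a, b, c, d, e, f)" by (metis prod.exhaust)
  have low: "(0, 0, 0, d, e, f) \<in> W" for d e f using sub by (auto simp: tail3_def)
  have k: "q - inverse q \<noteq> 0" using q0 q1 by (auto simp: field_simps power2_eq_square)
  have p: "q + inverse q \<noteq> 0" using q0 q2p1 by (auto simp: field_simps power2_eq_square)
  have abc: "(a, b, c, 0, 0, 0) \<in> W"
    using comb[OF x(1) low[of d e f], of 1 "-1"] by (simp add: xe)
  have y: "(2 * (q - inverse q) * b, 0, (q ^ 2 - 1) * c, 0, 0, 0) \<in> W"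
    using comb[OF invariantD(6)[OF W abc, of "(1, 0)"] abc, of 1 "-1"]
    by (simp add: opX_simple algebra_simps del: opX.simps)
  have "u1 \<in> W \<or> u3 \<in> W"
  proof (cases "c = 0")
    case False
    \<comment> \<open>a second application of \<open>X\<^bsup>\<alpha>\<^sub>1\<^esup> - 1\<close> kills the Jordan block\<close>
    have "(0, 0, (q ^ 2 - 1) * ((q ^ 2 - 1) * c), 0, 0, 0) \<in> W"
      using comb[OF invariantD(6)[OF W y, of "(1, 0)"] y, of 1 "-1"]
      by (simp add: opX_simple algebra_simps del: opX.simps)
    from invariantD(4)[OF W this, of "inverse ((q ^ 2 - 1) * ((q ^ 2 - 1) * c))"]
    show ?thesis using False q1 by (simp add: u3_def del: inverse_mult_distrib)
  next
    case c: True
    show ?thesis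
    proof (cases "b = 0")
      case False
      from invariantD(4)[OF W y, of "inverse (2 * (q - inverse q) * b)"]
      show ?thesis using False c k by (simp add: u1_def del: inverse_mult_distrib)
    next
      case True
      then have "a \<noteq> 0" using x(2) c by (auto simp: xe tail3_def)
      with invariantD(4)[OF W abc, of "inverse a"] True c show ?thesis by (simp add: u1_def)
    qed
  qed
  moreover have "u1 \<in> W" if "u3 \<in> W"
  proof -
    define z where "z = - 3 * (q + inverse q)"
    have "(z, 0, 0, 0, 0, 0) \<in> W"
      using comb[OF invariantD(5)[OF W that, of Node2] that, of 1 "inverse q"]
      by (simp add: u3_def zero_prod_def z_def)
    from invariantD(4)[OF W this, of "inverse z"]
    show ?thesis using p by (simp add: u1_def z_def del: inverse_mult_distrib distrib_left_numeral)
  qed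
  ultimately have 1: "u1 \<in> W" by blast
  have 2: "u2 \<in> W" using invariantD(5)[OF W 1, of Node1] by (simp add: u1_def u2_def)
  have "(0, q, 1, 0, 0, 0) \<in> W"
    using comb[OF invariantD(5)[OF W 2, of Node2] 1, of 1 "-3"]
    by (simp add: u1_def u2_def zero_prod_def)
  from comb[OF this 2, of 1 "- q"] have 3: "u3 \<in> W" by (simp add: u2_def u3_def zero_prod_def)
  have "z \<in> W" for z
  proof -
    obtain a b c d e f where z: "z = (a, b, c, d, e, f)" by (metis prod.exhaust)
    have "scl 1 (scl a u1 + scl b u2) + scl 1 (scl c u3 + scl 1 (0, 0, 0, d, e, f)) \<in> W"
      by (intro comb 1 2 3 low)
    then show ?thesis by (simp add: z u1_def u2_def u3_def)
  qed
  then show ?thesis by blast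
qed

text \<open>
  The weights of \<open>e\<^sub>4\<close> and \<open>e\<^sub>5\<close> differ, so one of the two vectors can be extracted. The operator \<open>T\<^sub>2\<close> leads
  from \<open>e\<^sub>4\<close> to \<open>e\<^sub>5\<close>, and back because its coefficient there is nonzero by the first assumption.
\<close>

lemma tail1_maximal:
  assumes C: "q ^ 4 + q ^ 2 + 1 \<noteq> 0" and W: "invariant q W" and sub: "tail1 \<subseteq> W" "W \<subseteq> tail3"
    and x: "x \<in> W" "x \<notin> tail1"
  shows "tail3 \<subseteq> W"
proof -
  note comb = invariant_combination[OF W]
  define u4 u5 :: vec where "u4 = (0, 0, 0, 1, 0, 0)" and "u5 = (0, 0, 0, 0, 1, 0)"
  obtain d e f where xe: "x = (0, 0, 0, d, e, f)" using x sub by (auto simp: tail3_def)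
  have low: "(0, 0, 0, 0, 0, f) \<in> W" for f using sub by (auto simp: tail1_def)
  have de: "(0, 0, 0, d, e, 0) \<in> W"
    using comb[OF x(1) low[of f], of 1 "-1"] by (simp add: xe zero_prod_def)
  have "u4 \<in> W \<or> u5 \<in> W"
  proof (cases "d = 0")
    case False
    have "(0, 0, 0, (inverse q ^ 2 - q ^ 2) * d, 0, 0) \<in> W"
      using comb[OF invariantD(6)[OF W de, of "(1, 0)"] de, of 1 "- (q ^ 2)"]
      by (simp add: opX_simple algebra_simps zero_prod_def del: opX.simps)
    from invariantD(4)[OF W this, of "inverse ((inverse q ^ 2 - q ^ 2) * d)"]
    show ?thesis using False weight_inequalities(2) by (simp add: u4_def del: inverse_mult_distrib)
  next
    case True
    then have "e \<noteq> 0" using x(2) by (auto simp: xe tail1_def)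
    with invariantD(4)[OF W de, of "inverse e"] True show ?thesis by (simp add: u5_def)
  qed
  moreover have 5: "u5 \<in> W" if "u4 \<in> W"
    using comb[OF invariantD(5)[OF W that, of Node2] that, of 1 "- (q ^ 3 * inverse (q ^ 2 + 1))"]
    by (simp add: u4_def u5_def zero_prod_def)
  moreover have "u4 \<in> W" if "u5 \<in> W"
  proof -
    have "(0, 0, 0, (q ^ 4 + q ^ 2 + 1) * inverse (q ^ 2 + 1) ^ 2, 0, 0) \<in> W"
      using comb[OF invariantD(5)[OF W that, of Node2] that, of 1 "inverse q * inverse (q ^ 2 + 1)"]
      by (simp add: u5_def zero_prod_def)
    from invariantD(4)[OF W this, of "inverse ((q ^ 4 + q ^ 2 + 1) * inverse (q ^ 2 + 1) ^ 2)"]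
    show ?thesis using C q2p1 by (simp add: u4_def del: inverse_mult_distrib)
  qed
  ultimately have "u4 \<in> W" "u5 \<in> W" by auto
  then have "scl 1 (scl d u4 + scl e u5) + scl 1 (0, 0, 0, 0, 0, f) \<in> W" for d e f
    by (intro comb low)
  then show ?thesis by (auto simp: tail3_def u4_def u5_def)
qed

lemma primitive_cube_root_iff:
  "primitive_root_of_unity 3 (q ^ 2) \<longleftrightarrow> q ^ 4 + q ^ 2 + 1 = 0"
proof -
  have "(q ^ 2 - 1) * (q ^ 4 + q ^ 2 + 1) = (q ^ 2) ^ 3 - 1"
    by (simp add: algebra_simps flip: power_mult power_add)
  then have cube: "(q ^ 2) ^ 3 = 1 \<longleftrightarrow> q ^ 4 + q ^ 2 + 1 = 0" using q1 by auto
  have "(q ^ 2) ^ k \<noteq> 1" if "0 < k" "k < 3" for k :: nat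
  proof -
    have "k = 1 \<or> k = 2" using that by auto
    then show ?thesis using q1 qm1 power2_eq_1_iff[of "q ^ 2"] by auto
  qed
  then show ?thesis using cube by (auto simp: primitive_root_of_unity_def)
qed

end

locale coordinatised = equivariant +
  assumes g_inj: "g x = \<zero>\<^bsub>Q\<^esub> \<Longrightarrow> x = 0" and g_surj: "range g = carrier Q"
begin

lemma weight_space_Q: "weight_space q Q \<tau> = g ` {x. \<forall>l. opX q l x = scl (\<tau> l) x}"
proof -
  have UNIV: "invariant q UNIV" by (simp add: invariant_def)
  have diff: "g (x - y) = \<zero>\<^bsub>Q\<^esub> \<longleftrightarrow> x = y" for x y
    using g_inj[of "x - y"] g_zero by auto
  have Q: "Q\<lparr>carrier := range g\<rparr> = Q" by (simp add: g_surj)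
  show ?thesis using weight_space_image[OF UNIV, of \<tau>] unfolding diff Q by simp
qed

text \<open>
  Parts (a), (b) and (c) for any module isomorphic to the model. The submodule \<open>Msub\<close> is the image of
  \<open>tail1\<close>, and \<open>M'\<close> is the image of \<open>tail3\<close> in the quotient.
\<close>

theorem submodule_structure:
  defines "Msub \<equiv> weight_space q Q (wt6 q)"
  defines "M' \<equiv> (\<lambda>x. Msub +>\<^bsub>Q\<^esub> x) ` (weight_space q Q (wt5 q) <+>\<^bsub>Q\<^esub> weight_space q Q (wt4 q))"
  shows "submodule Msub (hecke q) Q" "one_dimensional q Q Msub"
    "submodule M' (hecke q) (quotient_module Q Msub)"
    "irreducible_module (hecke q) (quotient_module (quotient_module Q Msub) M')"
    "\<not> primitive_root_of_unity 3 (q ^ 2) \<Longrightarrow>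
      irreducible_module (hecke q) ((quotient_module Q Msub)\<lparr>carrier := M'\<rparr>)"
    "primitive_root_of_unity 3 (q ^ 2) \<Longrightarrow>
      submodule (weight_space q ((quotient_module Q Msub)\<lparr>carrier := M'\<rparr>) (wt5 q))
        (hecke q) ((quotient_module Q Msub)\<lparr>carrier := M'\<rparr>)"
proof -
  have Msub: "Msub = g ` tail1" unfolding Msub_def weight_space_Q weight_vectors ..
  show "submodule Msub (hecke q) Q" unfolding Msub by (rule image_submodule[OF invariant_tail1])
  have "g (0, 0, 0, 0, 0, 1) \<noteq> \<zero>\<^bsub>Q\<^esub>"
  proof
    assume "g (0, 0, 0, 0, 0, 1) = \<zero>\<^bsub>Q\<^esub>"
    from g_inj[OF this] show False by (simp add: zero_vec)
  qed
  moreover have "g (0, 0, 0, 0, 0, 1) \<in> Msub" unfolding Msub tail1_def by blast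
  moreover have "complex_line q Q (g (0, 0, 0, 0, 0, 1)) = g ` range (\<lambda>c. scl c (0, 0, 0, 0, 0, 1))"
    by (simp add: complex_line_def hecke_class_generators image_image flip: g_act)
  moreover have "range (\<lambda>c. scl c (0, 0, 0, 0, 0, 1)) = tail1"
    by (auto simp: tail1_def)
  moreover have "Msub \<subseteq> carrier Q" unfolding Msub using g_closed by blast
  ultimately show "one_dimensional q Q Msub"
    unfolding one_dimensional_def by (metis Msub)
  define h where "h x = Msub +>\<^bsub>Q\<^esub> g x" for x
  interpret h: equivariant q "quotient_module Q Msub" h
    using quotient_equivariant[OF invariant_tail1] unfolding h_def Msub .
  have h_ker: "h x = \<zero>\<^bsub>quotient_module Q Msub\<^esub> \<longleftrightarrow> x \<in> tail1" for x
    unfolding h_def Msub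
    by (rule quotient_kernel[OF invariant_tail1]) (use g_inj invariantD(1)[OF invariant_tail1] in blast)
  have h_surj: "range h = carrier (quotient_module Q Msub)"
    unfolding h_def Msub by (rule quotient_surj[OF invariant_tail1 g_surj])
  have M': "M' = h ` tail3"
  proof -
    have "weight_space q Q (wt5 q) <+>\<^bsub>Q\<^esub> weight_space q Q (wt4 q) = g ` {(0, 0, 0, d, e, 0) | d e. True}"
    proof -
      let ?A = "{(0, 0, 0, 0, e, 0) :: vec | e. True}"
      let ?B = "{(0, 0, 0, d, 0, 0) :: vec | d. True}"
      have "(\<Union>x\<in>g ` ?A. \<Union>y\<in>g ` ?B. {x \<oplus>\<^bsub>Q\<^esub> y}) = (\<Union>x\<in>?A. \<Union>y\<in>?B. {g (x + y)})"
        by (simp only: g_add UN_simps)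
      also have "\<dots> = g ` {x + y | x y. x \<in> ?A \<and> y \<in> ?B}" by blast
      also have "{x + y | x y. x \<in> ?A \<and> y \<in> ?B} = {(0, 0, 0, d, e, 0) :: vec | d e. True}" (is "?L = ?R")
      proof
        have "((0, 0, 0, d, e, 0) :: vec) = (0, 0, 0, 0, e, 0) + (0, 0, 0, d, 0, 0)" for d e :: complex
          by simp
        then show "?R \<subseteq> ?L" by blast
      qed auto
      finally show ?thesis
        unfolding weight_space_Q weight_vectors set_add_def' .
    qed
    then have "M' = h ` {(0, 0, 0, d, e, 0) | d e. True}"
      by (simp add: M'_def h_def image_image)
    moreover have "h (0, 0, 0, d, e, f) = h (0, 0, 0, d, e, 0)" for d e f
      using h.g_minus_eq_zero_iff[of "(0, 0, 0, d, e, f)" "(0, 0, 0, d, e, 0)"]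
      by (simp add: h_ker tail1_def zero_prod_def)
    ultimately show ?thesis unfolding tail3_def by blast
  qed
  show "submodule M' (hecke q) (quotient_module Q Msub)"
    unfolding M' by (rule h.image_submodule[OF invariant_tail3])
  {
    define j where "j x = M' +>\<^bsub>quotient_module Q Msub\<^esub> h x" for x
    interpret j: equivariant q "quotient_module (quotient_module Q Msub) M'" j
      using h.quotient_equivariant[OF invariant_tail3] unfolding j_def M' .
    have j_ker: "j x = \<zero>\<^bsub>quotient_module (quotient_module Q Msub) M'\<^esub> \<longleftrightarrow> x \<in> tail3" for x
      unfolding j_def M'
      by (rule h.quotient_kernel[OF invariant_tail3]) (auto simp: h_ker tail1_def tail3_def)
    have "range j = carrier (quotient_module (quotient_module Q Msub) M')"
      unfolding j_def M' by (rule h.quotient_surj[OF invariant_tail3 h_surj])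
    moreover have "irreducible_module (hecke q)
      (quotient_module (quotient_module Q Msub) M'\<lparr>carrier := range j\<rparr>)"
    proof (rule j.irreducible_image)
      have "(1, 0, 0, 0, 0, 0) \<notin> tail3" by (simp add: tail3_def)
      then show "\<exists>x\<in>UNIV. j x \<noteq> \<zero>\<^bsub>quotient_module (quotient_module Q Msub) M'\<^esub>"
        unfolding j_ker by blast
      show "UNIV \<subseteq> W" if "invariant q W"
        "{x \<in> UNIV. j x = \<zero>\<^bsub>quotient_module (quotient_module Q Msub) M'\<^esub>} \<subseteq> W" "x \<in> W"
        "j x \<noteq> \<zero>\<^bsub>quotient_module (quotient_module Q Msub) M'\<^esub>" for W x
        using tail3_maximal[OF that(1) _ that(3)] that(2,4) unfolding j_ker by blast
      show "invariant q UNIV" by (simp add: invariant_def)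
    qed
    ultimately show "irreducible_module (hecke q) (quotient_module (quotient_module Q Msub) M')"
      by simp
  }
  show "irreducible_module (hecke q) ((quotient_module Q Msub)\<lparr>carrier := M'\<rparr>)"
    if "\<not> primitive_root_of_unity 3 (q ^ 2)"
    unfolding M'
  proof (rule h.irreducible_image[OF invariant_tail3])
    have "(0, 0, 0, 1, 0, 0) \<in> tail3" "(0, 0, 0, 1, 0, 0) \<notin> tail1" by (auto simp: tail3_def tail1_def)
    then show "\<exists>x\<in>tail3. h x \<noteq> \<zero>\<^bsub>quotient_module Q Msub\<^esub>" unfolding h_ker by blast
    show "tail3 \<subseteq> W" if "invariant q W" "W \<subseteq> tail3"
      "{x \<in> tail3. h x = \<zero>\<^bsub>quotient_module Q Msub\<^esub>} \<subseteq> W" "x \<in> W"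
      "h x \<noteq> \<zero>\<^bsub>quotient_module Q Msub\<^esub>" for W x
    proof (rule tail1_maximal[OF _ that(1) _ that(2) that(4)])
      show "tail1 \<subseteq> W" using that(3) by (auto simp: h_ker tail1_def tail3_def)
      show "x \<notin> tail1" using that(5) by (simp add: h_ker)
    qed (use \<open>\<not> primitive_root_of_unity 3 (q ^ 2)\<close> primitive_cube_root_iff in blast)
  qed
  show "submodule (weight_space q ((quotient_module Q Msub)\<lparr>carrier := M'\<rparr>) (wt5 q))
        (hecke q) ((quotient_module Q Msub)\<lparr>carrier := M'\<rparr>)"
    if "primitive_root_of_unity 3 (q ^ 2)"
    unfolding M' h.weight_space_image[OF invariant_tail3] h_ker weight_vectors_mod_tail1
    by (rule h.restrict_equivariant_submodule[OF invariant_tail3 invariant_tail2])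
      (use that primitive_cube_root_iff in \<open>auto simp: tail2_def tail3_def\<close>)
qed

end

section \<open>The induced module is the model\<close>

context hecke_parameter
begin

definition hecke_act :: "free_algebra set \<Rightarrow> vec \<Rightarrow> vec" where
  "hecke_act h = act q (SOME f. h = hecke_class q f)"

lemma hecke_act_class: "hecke_act (hecke_class q f) x = act q f x"
proof -
  have "hecke_class q f = hecke_class q (SOME g. hecke_class q f = hecke_class q g)"
    by (rule someI[of "\<lambda>g. hecke_class q f = hecke_class q g"]) simp
  then have "act q (f - (SOME g. hecke_class q f = hecke_class q g)) x = 0"
    unfolding hecke_class_eq_iff by (rule act_hecke_ideal)
  then show ?thesis by (simp add: hecke_act_def word_rep.act_diff)
qed

end

lemma weight_at_even: "weight_at 1 (q ^ 2) l = q powi (2 * snd l)"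
  by (simp add: weight_at_def power_int_mult)

locale hecke_line = hecke_parameter q for q +
  fixes L :: "(free_algebra set, 'b) module" and v :: 'b
  assumes line: "line_module q Node2 q (weight_at 1 (q ^ 2)) L v"
begin

abbreviation P where "P \<equiv> parabolic q Node2"

sublocale L: left_module P L
  using line by (simp add: line_module_def)

lemma P_simps: "x \<oplus>\<^bsub>P\<^esub> y = x \<oplus>\<^bsub>hecke q\<^esub> y" "x \<otimes>\<^bsub>P\<^esub> y = x \<otimes>\<^bsub>hecke q\<^esub> y"
  "\<one>\<^bsub>P\<^esub> = \<one>\<^bsub>hecke q\<^esub>" "\<zero>\<^bsub>P\<^esub> = \<zero>\<^bsub>hecke q\<^esub>"
  by (simp_all add: parabolic_def)

lemma P_generators: "hscal q c \<in> carrier P" "hT q Node2 \<in> carrier P" "hX q l \<in> carrier P"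
  by (auto simp: parabolic_def intro!: generate_ring.incl)

lemma P_subset: "carrier P \<subseteq> carrier (hecke q)"
proof -
  have "range (hscal q) \<union> {hT q Node2} \<union> range (hX q) \<subseteq> carrier (hecke q)"
    by (auto simp: hecke_class_generators)
  from hecke.generate_ring_incl[OF this] show ?thesis by (simp add: parabolic_def)
qed

sublocale I: tensor_induction "hecke q" P L
  by (intro tensor_induction.intro tensor_induction_axioms.intro hecke.ring_axioms
      L.left_module_axioms P_subset)

lemma v: "v \<in> carrier L" "v \<noteq> \<zero>\<^bsub>L\<^esub>"
  and carrier_L: "carrier L = range (\<lambda>c. hscal q c \<odot>\<^bsub>L\<^esub> v)"
  and T2_v: "hT q Node2 \<odot>\<^bsub>L\<^esub> v = hscal q q \<odot>\<^bsub>L\<^esub> v"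
  using line unfolding line_module_def complex_line_def by blast+

lemma X_v: "hX q l \<odot>\<^bsub>L\<^esub> v = hscal q (q powi (2 * snd l)) \<odot>\<^bsub>L\<^esub> v"
  using line unfolding line_module_def weight_at_even by blast

lemma hscal_add: "hscal q (a + b) = hscal q a \<oplus>\<^bsub>hecke q\<^esub> hscal q b"
  by (simp add: hecke_class_generators hecke_class_add fscal_add)

lemma hscal_mult: "hscal q (a * b) = hscal q a \<otimes>\<^bsub>hecke q\<^esub> hscal q b"
  by (simp add: hecke_class_generators hecke_class_mult fscal_mult)

lemma hscal_add_smult: "x \<in> carrier L \<Longrightarrow>
    hscal q (a + b) \<odot>\<^bsub>L\<^esub> x = hscal q a \<odot>\<^bsub>L\<^esub> x \<oplus>\<^bsub>L\<^esub> hscal q b \<odot>\<^bsub>L\<^esub> x"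
  using L.smult_l_distr[OF P_generators(1,1)] by (simp add: hscal_add P_simps)

lemma hscal_mult_smult: "x \<in> carrier L \<Longrightarrow>
    hscal q (a * b) \<odot>\<^bsub>L\<^esub> x = hscal q a \<odot>\<^bsub>L\<^esub> (hscal q b \<odot>\<^bsub>L\<^esub> x)"
  using L.smult_assoc[OF P_generators(1,1)] by (simp add: hscal_mult P_simps)

lemma hscal_one_smult: "x \<in> carrier L \<Longrightarrow> hscal q 1 \<odot>\<^bsub>L\<^esub> x = x"
  using L.smult_one by (simp add: P_simps hecke_class_one hecke_class_generators)

lemma hscal_v_inj:
  assumes "hscal q a \<odot>\<^bsub>L\<^esub> v = hscal q b \<odot>\<^bsub>L\<^esub> v" shows "a = b"
proof (rule ccontr)
  assume "a \<noteq> b"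
  have closed: "hscal q c \<odot>\<^bsub>L\<^esub> v \<in> carrier L" for c
    by (rule L.smult_closed[OF P_generators(1) v(1)])
  have "hscal q (a - b) \<odot>\<^bsub>L\<^esub> v \<oplus>\<^bsub>L\<^esub> hscal q b \<odot>\<^bsub>L\<^esub> v = hscal q b \<odot>\<^bsub>L\<^esub> v"
    using hscal_add_smult[OF v(1), of "a - b" b] assms by simp
  then have zero: "hscal q (a - b) \<odot>\<^bsub>L\<^esub> v = \<zero>\<^bsub>L\<^esub>"
    using closed by (simp add: L.M.add.r_cancel_one)
  have "v = hscal q (inverse (a - b) * (a - b)) \<odot>\<^bsub>L\<^esub> v"
    using \<open>a \<noteq> b\<close> hscal_one_smult[OF v(1)] by simp
  also have "\<dots> = hscal q (inverse (a - b)) \<odot>\<^bsub>L\<^esub> \<zero>\<^bsub>L\<^esub>"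
    unfolding hscal_mult_smult[OF v(1)] zero ..
  also have "\<dots> = \<zero>\<^bsub>L\<^esub>" by (rule L.smult_zero_right[OF P_generators(1)])
  finally show False using v(2) by simp
qed

definition coef :: "'b \<Rightarrow> complex" where
  "coef x = (THE c. x = hscal q c \<odot>\<^bsub>L\<^esub> v)"

lemma coef_hscal [simp]: "coef (hscal q c \<odot>\<^bsub>L\<^esub> v) = c"
  unfolding coef_def by (rule the_equality) (auto dest: hscal_v_inj)

text \<open>
  The parabolic subalgebra acts on \<open>e\<^sub>1\<close> and on \<open>v\<close> by the same character. Since it is given by
  generators, this is an induction over its elements.
\<close>

lemma P_character:
  assumes "s \<in> carrier P"
  shows "\<exists>f c. s = hecke_class q f \<and> act q f e1 = scl c e1 \<and> s \<odot>\<^bsub>L\<^esub> v = hscal q c \<odot>\<^bsub>L\<^esub> v"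
proof -
  let ?G = "range (hscal q) \<union> {hT q Node2} \<union> range (hX q)"
  have carrier_P: "carrier P = generate_ring (hecke q) ?G" by (simp add: parabolic_def)
  have "s \<in> generate_ring (hecke q) ?G" using assms by (simp add: carrier_P)
  then show ?thesis
  proof induction
    case one
    show ?case
      using hscal_one_smult[OF v(1)] by (intro exI[of _ 1]) (auto simp: hecke_class_one hecke_class_generators e1_def)
  next
    case (incl h)
    then consider c where "h = hscal q c" | "h = hT q Node2" | l where "h = hX q l" by blast
    then show ?case
    proof cases
      case 1
      then show ?thesis
        by (intro exI[of _ "fscal c"] exI[of _ c]) (simp add: hecke_class_generators)
    next
      case 2
      then show ?thesis
        by (intro exI[of _ "fT Node2"] exI[of _ q]) (simp add: T2_v[unfolded hecke_class_generators(2)] hecke_class_generators(2) e1_def)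
    next
      case 3
      then show ?thesis
        by (intro exI[of _ "fX l"] exI[of _ "q powi (2 * snd l)"])
          (cases l, simp add: X_v[unfolded hecke_class_generators(3)] hecke_class_generators(3) e1_def)
    qed
  next
    case (a_inv h)
    then obtain f c where h: "h = hecke_class q f" "act q f e1 = scl c e1"
      "h \<odot>\<^bsub>L\<^esub> v = hscal q c \<odot>\<^bsub>L\<^esub> v" by blast
    have "\<ominus>\<^bsub>hecke q\<^esub> h = hscal q (- 1) \<otimes>\<^bsub>P\<^esub> h"
      by (simp add: h(1) hecke_class_uminus hecke_class_generators P_simps hecke_class_mult fscal_uminus)
    also have "\<dots> \<odot>\<^bsub>L\<^esub> v = hscal q (- 1) \<odot>\<^bsub>L\<^esub> (hscal q c \<odot>\<^bsub>L\<^esub> v)"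
      using a_inv.hyps by (simp add: L.smult_assoc[OF P_generators(1)] carrier_P v h(3))
    also have "\<dots> = hscal q (- c) \<odot>\<^bsub>L\<^esub> v" by (simp flip: hscal_mult_smult[OF v(1)])
    finally show ?case
      by (intro exI[of _ "- f"] exI[of _ "- c"])
        (simp add: h(1,2) hecke_class_uminus word_rep.act_uminus)
  next
    case (eng_add h k)
    then obtain f c f' c' where h: "h = hecke_class q f" "act q f e1 = scl c e1"
      "h \<odot>\<^bsub>L\<^esub> v = hscal q c \<odot>\<^bsub>L\<^esub> v" and k: "k = hecke_class q f'" "act q f' e1 = scl c' e1"
      "k \<odot>\<^bsub>L\<^esub> v = hscal q c' \<odot>\<^bsub>L\<^esub> v" by blast
    have "(h \<oplus>\<^bsub>hecke q\<^esub> k) \<odot>\<^bsub>L\<^esub> v = hscal q (c + c') \<odot>\<^bsub>L\<^esub> v"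
      using L.smult_l_distr[of h k v] eng_add.hyps
      by (simp add: carrier_P v P_simps h(3) k(3) hscal_add_smult)
    then show ?case
      by (intro exI[of _ "f + f'"] exI[of _ "c + c'"])
        (simp add: h(1,2) k(1,2) hecke_class_add word_rep.act_plus vec.scale_left_distrib)
  next
    case (eng_mult h k)
    then obtain f c f' c' where h: "h = hecke_class q f" "act q f e1 = scl c e1"
      "h \<odot>\<^bsub>L\<^esub> v = hscal q c \<odot>\<^bsub>L\<^esub> v" and k: "k = hecke_class q f'" "act q f' e1 = scl c' e1"
      "k \<odot>\<^bsub>L\<^esub> v = hscal q c' \<odot>\<^bsub>L\<^esub> v" by blast
    have hk: "h \<in> carrier P" "k \<in> carrier P" using eng_mult.hyps by (simp_all add: carrier_P)
    have comm: "h \<otimes>\<^bsub>P\<^esub> hscal q c' = hscal q c' \<otimes>\<^bsub>P\<^esub> h"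
      by (simp add: P_simps h(1) hecke_class_generators hecke_class_mult fscal_commute)
    have "(h \<otimes>\<^bsub>P\<^esub> k) \<odot>\<^bsub>L\<^esub> v = (h \<otimes>\<^bsub>P\<^esub> hscal q c') \<odot>\<^bsub>L\<^esub> v"
      using hk P_generators v by (simp add: L.smult_assoc k(3))
    also have "\<dots> = hscal q (c' * c) \<odot>\<^bsub>L\<^esub> v"
      unfolding comm using hk P_generators v by (simp add: L.smult_assoc h(3) hscal_mult_smult)
    finally show ?case
      by (intro exI[of _ "f * f'"] exI[of _ "c' * c"])
        (simp add: h(1,2) k(1,2) hecke_class_mult word_rep.act_mult word_rep.act_scale_right P_simps)
  qed
qed

abbreviation M where "M \<equiv> induced_module (hecke q) P L"

sublocale M: left_module "hecke q" M
  by (rule I.induced_left_module)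

definition u where "u = I.tensor \<one>\<^bsub>hecke q\<^esub> v"

lemma u_closed: "u \<in> carrier M"
  unfolding u_def by (intro I.tensor_closed hecke.one_closed v)

lemma smult_u: "h \<in> carrier (hecke q) \<Longrightarrow> h \<odot>\<^bsub>M\<^esub> u = I.tensor h v"
  unfolding u_def by (subst I.smult_tensor) (auto simp: v)

text \<open>
  The biadditive map that sends \<open>h\<close> and \<open>cv\<close> to \<open>c(he\<^sub>1)\<close> is balanced, because the parabolic
  subalgebra acts on \<open>v\<close> and on \<open>e\<^sub>1\<close> by the same character. It realises the map from the induced module
  to the model.
\<close>

lemma tensor_zero_imp_act_zero:
  assumes "hecke_class q f \<odot>\<^bsub>M\<^esub> u = \<zero>\<^bsub>M\<^esub>"
  shows "act q f e1 = 0"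
proof -
  let ?\<phi> = "\<lambda>a x. scl (coef x) (hecke_act a e1)"
  have "?\<phi> (hecke_class q f) v = 0"
  proof (rule I.tensor_universal[where \<phi> = ?\<phi> and a = "hecke_class q f" and x = v])
    show "?\<phi> (a \<oplus>\<^bsub>hecke q\<^esub> b) x = ?\<phi> a x + ?\<phi> b x"
      if "a \<in> carrier (hecke q)" "b \<in> carrier (hecke q)" for a b x
      using that by (auto simp: carrier_hecke hecke_class_add hecke_act_class word_rep.act_plus vec.scale_right_distrib)
    show "?\<phi> a (x \<oplus>\<^bsub>L\<^esub> y) = ?\<phi> a x + ?\<phi> a y"
      if xy: "x \<in> carrier L" "y \<in> carrier L" for a x y
    proof -
      obtain c d where "x = hscal q c \<odot>\<^bsub>L\<^esub> v" "y = hscal q d \<odot>\<^bsub>L\<^esub> v"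
        using xy by (auto simp: carrier_L)
      then show ?thesis
        by (simp add: hscal_add_smult[OF v(1), symmetric] vec.scale_left_distrib)
    qed
    show "?\<phi> (a \<otimes>\<^bsub>hecke q\<^esub> s) x = ?\<phi> a (s \<odot>\<^bsub>L\<^esub> x)"
      if a: "a \<in> carrier (hecke q)" and s: "s \<in> carrier P" and x: "x \<in> carrier L" for a s x
    proof -
      obtain c where c: "x = hscal q c \<odot>\<^bsub>L\<^esub> v" using x by (auto simp: carrier_L)
      obtain h where h: "a = hecke_class q h" using a by (auto simp: carrier_hecke)
      obtain k d where k: "s = hecke_class q k" "act q k e1 = scl d e1"
        "s \<odot>\<^bsub>L\<^esub> v = hscal q d \<odot>\<^bsub>L\<^esub> v" using P_character[OF s] by blast
      have comm: "s \<otimes>\<^bsub>P\<^esub> hscal q c = hscal q c \<otimes>\<^bsub>P\<^esub> s"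
        by (simp add: P_simps k(1) hecke_class_generators hecke_class_mult fscal_commute)
      have "s \<odot>\<^bsub>L\<^esub> x = (s \<otimes>\<^bsub>P\<^esub> hscal q c) \<odot>\<^bsub>L\<^esub> v"
        using s P_generators v by (simp add: L.smult_assoc c)
      also have "\<dots> = hscal q (c * d) \<odot>\<^bsub>L\<^esub> v"
        unfolding comm using s P_generators v by (simp add: L.smult_assoc k(3) hscal_mult_smult)
      finally have "coef (s \<odot>\<^bsub>L\<^esub> x) = c * d" by simp
      then show ?thesis
        by (simp add: c h k(1,2) hecke_class_mult hecke_act_class word_rep.act_mult word_rep.act_scale_right)
    qed
    show "I.tensor (hecke_class q f) v = \<zero>\<^bsub>M\<^esub>" using assms by (simp add: smult_u)
  qed (simp_all add: v)
  moreover have "coef v = 1" using coef_hscal[of 1] hscal_one_smult[OF v(1)] by simp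
  ultimately show ?thesis by (simp add: hecke_act_class)
qed

definition J :: "free_algebra set" where
  "J = {f. hecke_class q f \<odot>\<^bsub>M\<^esub> u = \<zero>\<^bsub>M\<^esub>}"

lemma diff_in_J_iff: "f - g \<in> J \<longleftrightarrow> hecke_class q f \<odot>\<^bsub>M\<^esub> u = hecke_class q g \<odot>\<^bsub>M\<^esub> u"
proof -
  have "hecke_class q f \<odot>\<^bsub>M\<^esub> u = hecke_class q (f - g) \<odot>\<^bsub>M\<^esub> u \<oplus>\<^bsub>M\<^esub> hecke_class q g \<odot>\<^bsub>M\<^esub> u"
    by (simp add: hecke_class_add u_closed flip: M.smult_l_distr)
  then show ?thesis
    using M.smult_closed[OF hecke_class_closed u_closed]
    by (simp add: J_def M.M.add.r_cancel_one)
qed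

lemma line_in_J:
  assumes "hecke_class q f \<in> carrier P" "hecke_class q g \<in> carrier P"
    and "hecke_class q f \<odot>\<^bsub>L\<^esub> v = hecke_class q g \<odot>\<^bsub>L\<^esub> v"
  shows "f - g \<in> J"
proof -
  have "hecke_class q h \<odot>\<^bsub>M\<^esub> u = I.tensor \<one>\<^bsub>hecke q\<^esub> (hecke_class q h \<odot>\<^bsub>L\<^esub> v)"
    if "hecke_class q h \<in> carrier P" for h
    using I.smult_tensor_right[OF hecke.one_closed that v(1)] by (simp add: smult_u)
  then show ?thesis unfolding diff_in_J_iff using assms by simp
qed

sublocale cyclic_presentation q J
proof
  show "0 \<in> J" by (simp add: J_def M.smult_zero_left u_closed flip: hecke_class_zero)
  show "f - g \<in> J" if "f \<in> J" "g \<in> J" for f g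
    using that unfolding diff_in_J_iff by (simp add: J_def)
  show "h * f \<in> J" if "f \<in> J" for f h
    using that by (simp add: J_def M.smult_assoc M.smult_zero_right u_closed flip: hecke_class_mult)
  show "r * h \<in> J" if "r \<in> hecke_relations q" for r h
  proof -
    have "r * h \<in> hecke_ideal q"
      using ideal.I_r_closed[OF ideal_hecke_ideal hecke_relations_subset[OF that], of h] by simp
    then have "hecke_class q (r * h) = \<zero>\<^bsub>hecke q\<^esub>"
      by (simp add: hecke_class_zero hecke_class_eq_iff)
    then show ?thesis by (simp add: J_def M.smult_zero_left u_closed)
  qed
  show "fT Node2 - fscal q \<in> J"
    using line_in_J P_generators T2_v by (simp add: hecke_class_generators)
  show "fX l - fscal (q powi (2 * snd l)) \<in> J" for l
    using line_in_J P_generators X_v by (simp add: hecke_class_generators)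
  show "act q f e1 = 0" if "f \<in> J" for f
    using that tensor_zero_imp_act_zero by (simp add: J_def)
qed

definition coordinates :: "vec \<Rightarrow> _" where
  "coordinates x = hecke_class q (SOME f. act q f e1 = x) \<odot>\<^bsub>M\<^esub> u"

lemma coordinates_act: "coordinates (act q f e1) = hecke_class q f \<odot>\<^bsub>M\<^esub> u"
proof -
  have "act q (SOME g. act q g e1 = act q f e1) e1 = act q f e1"
    by (rule someI[of "\<lambda>g. act q g e1 = act q f e1"]) simp
  then have "(SOME g. act q g e1 = act q f e1) - f \<in> J"
    by (intro act_zero_imp_J) (simp add: word_rep.act_diff)
  then show ?thesis unfolding diff_in_J_iff coordinates_def .
qed

text \<open>
  The isomorphism from the model to the induced module sends \<open>fe\<^sub>1\<close> to \<open>f(1 \<otimes> v)\<close>. It is well defined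
  because the relations bound the dimension of the module by six, and injective because of the
  universal property of the tensor product.
\<close>

theorem coordinatised_induced_module: "coordinatised q M coordinates"
proof
  fix x y f
  obtain h where x: "x = act q h e1" using act_e1_surj by metis
  obtain k where y: "y = act q k e1" using act_e1_surj by metis
  show "coordinates x \<in> carrier M"
    unfolding x coordinates_act by (intro M.smult_closed hecke_class_closed u_closed)
  show "coordinates (x + y) = coordinates x \<oplus>\<^bsub>M\<^esub> coordinates y"
    unfolding x y word_rep.act_plus[symmetric] coordinates_act
    by (simp add: u_closed M.smult_l_distr flip: hecke_class_add)
  show "coordinates (act q f x) = hecke_class q f \<odot>\<^bsub>M\<^esub> coordinates x"
    unfolding x word_rep.act_mult[symmetric] coordinates_act
    by (simp add: u_closed M.smult_assoc flip: hecke_class_mult)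
  show "x = 0" if "coordinates x = \<zero>\<^bsub>M\<^esub>"
    using that tensor_zero_imp_act_zero by (simp add: x coordinates_act)
next
  have "m \<in> range coordinates" if "m \<in> carrier M" for m
  proof -
    have "\<exists>s\<in>carrier P. x = s \<odot>\<^bsub>L\<^esub> v" if "x \<in> carrier L" for x
      using that P_generators(1) by (auto simp: carrier_L)
    then obtain r where "r \<in> carrier (hecke q)" "m = r \<odot>\<^bsub>M\<^esub> u"
      using I.induced_cyclic[OF v(1) _ \<open>m \<in> carrier M\<close>] by (auto simp: u_def)
    then obtain f where "m = hecke_class q f \<odot>\<^bsub>M\<^esub> u" by (auto simp: carrier_hecke)
    then show ?thesis by (metis coordinates_act rangeI)
  qed
  moreover have "coordinates x \<in> carrier M" for x
    unfolding coordinates_def by (intro M.smult_closed hecke_class_closed u_closed)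
  ultimately show "range coordinates = carrier M" by blast
qed

end

section \<open>The orbit of the weight\<close>

lemma reflection_involution: "reflection i (reflection i l) = l"
  by (cases i) (auto simp: reflection_def pairing_def prod_eq_iff)

lemma bij_reflection: "bij (reflection i)"
  by (rule o_bij[of "reflection i"]) (auto simp: fun_eq_iff reflection_involution)

lemma weight_act_reflection: "weight_act (reflection i) t l = t (reflection i l)"
proof -
  have "inv_into UNIV (reflection i) = reflection i"
    by (rule inv_unique_comp) (auto simp: fun_eq_iff reflection_involution)
  then show ?thesis by (simp add: weight_act_def)
qed

lemma weight_act_comp: "bij u \<Longrightarrow> bij w \<Longrightarrow> weight_act (u \<circ> w) t = weight_act u (weight_act w t)"
  by (simp add: weight_act_def fun_eq_iff o_inv_distrib)

lemma weight_orbit: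
  fixes q :: complex
  defines "t \<equiv> weight_at 1 (q ^ 2)"
  shows "weight_act s2 t = (\<lambda>l. q powi (2 * fst l - 2 * snd l))"
    "weight_act (s1 \<circ> s2) t = wt4 q"
    "weight_act (s2 \<circ> s1 \<circ> s2) t = wt5 q"
    "weight_act (s1 \<circ> s2 \<circ> s1 \<circ> s2) t = wt6 q"
    "weight_act (s1 \<circ> s2 \<circ> s1 \<circ> s2 \<circ> s1 \<circ> s2) t = (\<lambda>l. q powi (- 2 * snd l))"
  by (auto simp: fun_eq_iff weight_act_comp bij_comp bij_reflection weight_act_reflection t_def
      weight_at_even wt4_def wt5_def wt6_def reflection_def pairing_def algebra_simps
      intro!: arg_cong[where f = "power_int q"])

section \<open>Exchanging the two eigenvalues\<close>

text \<open>
  \<open>q\<close> and \<open>- q\<^sup>-\<^sup>1\<close> are the two roots of the quadratic relation; the relations contain only their sum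
  \<open>q - q\<^sup>-\<^sup>1\<close>.
\<close>

lemma hecke_ideal_swap: "hecke_ideal (- inverse q) = hecke_ideal q"
proof -
  have "- inverse q - inverse (- inverse q) = q - inverse q" by simp
  then have "r \<in> hecke_relations (- inverse q) \<longleftrightarrow> r \<in> hecke_relations q" for r
    by (simp add: hecke_relations.simps)
  then have "hecke_relations (- inverse q) = hecke_relations q" by blast
  then show ?thesis by (simp add: hecke_ideal_def)
qed

lemma hecke_swap: "hecke (- inverse q) = hecke q" "hscal (- inverse q) = hscal q"
  "hT (- inverse q) = hT q" "hX (- inverse q) = hX q"
  by (simp_all add: hecke_def hscal_def hT_def hX_def fun_eq_iff hecke_ideal_swap)

lemma module_notions_swap:
  "parabolic (- inverse q) = parabolic q"
  "weight_space (- inverse q) = weight_space q"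
  "one_dimensional (- inverse q) = one_dimensional q"
  "line_module (- inverse q) = line_module q"
  by (simp_all add: fun_eq_iff parabolic_def weight_space_def one_dimensional_def complex_line_def
      line_module_def hecke_swap)

lemma powi_swap: "(- inverse q) powi (2 * n) = q powi (- 2 * n)" for q :: complex
  by (simp add: power_int_mult power_int_minus power_inverse power_int_inverse)

lemma weights_swap:
  "wt6 (- inverse q) = (\<lambda>l. q powi (2 * fst l - 2 * snd l))"
  "wt5 (- inverse q) = wt4 q" "wt4 (- inverse q) = wt5 q"
proof
  show "wt6 (- inverse q) l = q powi (2 * fst l - 2 * snd l)" for l
    using powi_swap[of q "snd l - fst l"] by (simp add: wt6_def right_diff_distrib)
next
  show "wt5 (- inverse q) = wt4 q"
  proof
    show "wt5 (- inverse q) l = wt4 q l" for l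
      using powi_swap[of q "fst l - 2 * snd l"] by (simp add: wt4_def wt5_def right_diff_distrib)
  qed
  show "wt4 (- inverse q) = wt5 q"
  proof
    show "wt4 (- inverse q) l = wt5 q l" for l
      using powi_swap[of q "2 * snd l - fst l"] by (simp add: wt4_def wt5_def right_diff_distrib)
  qed
qed

theorem proposition24:
  fixes q :: complex
    and t :: "lattice \<Rightarrow> complex"
    and w0 :: "lattice \<Rightarrow> lattice"
    and L :: "(free_algebra set, 'v) module" and vt :: 'v
    and L' :: "(free_algebra set, 'u) module" and vw0t :: 'u
  assumes q: "q \<noteq> 0" "q ^ 2 \<noteq> 1" "q ^ 2 \<noteq> -1"
    and t: "t = weight_at 1 (q ^ 2)"
    and w0: "w0 = s1 \<circ> s2 \<circ> s1 \<circ> s2 \<circ> s1 \<circ> s2"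
    and L: "line_module q Node2 q t L vt"
    and L': "line_module q Node2 (- inverse q) (weight_act w0 t) L' vw0t"
    and M: "M = induced_module (hecke q) (parabolic q Node2) L"
    and N: "N = induced_module (hecke q) (parabolic q Node2) L'"
    and Msub: "Msub = weight_space q M (weight_act (s1 \<circ> s2 \<circ> s1 \<circ> s2) t)"
    and M': "M' = (\<lambda>x. Msub +>\<^bsub>M\<^esub> x) `
               (weight_space q M (weight_act (s2 \<circ> s1 \<circ> s2) t)
                  <+>\<^bsub>M\<^esub> weight_space q M (weight_act (s1 \<circ> s2) t))"
    and Nsub: "Nsub = weight_space q N (weight_act s2 t)"
    and N': "N' = (\<lambda>x. Nsub +>\<^bsub>N\<^esub> x) `
               (weight_space q N (weight_act (s1 \<circ> s2) t)
                  <+>\<^bsub>N\<^esub> weight_space q N (weight_act (s2 \<circ> s1 \<circ> s2) t))"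
  shows
    "(submodule Msub (hecke q) M \<and> one_dimensional q M Msub \<and>
      submodule M' (hecke q) (quotient_module M Msub) \<and>
      irreducible_module (hecke q) (quotient_module (quotient_module M Msub) M'))
   \<and> (\<not> primitive_root_of_unity 3 (q ^ 2) \<longrightarrow>
      irreducible_module (hecke q) ((quotient_module M Msub)\<lparr>carrier := M'\<rparr>))
   \<and> (primitive_root_of_unity 3 (q ^ 2) \<longrightarrow>
      submodule
        (weight_space q ((quotient_module M Msub)\<lparr>carrier := M'\<rparr>) (weight_act (s2 \<circ> s1 \<circ> s2) t))
        (hecke q) ((quotient_module M Msub)\<lparr>carrier := M'\<rparr>))
   \<and> (submodule Nsub (hecke q) N \<and> one_dimensional q N Nsub \<and>
      submodule N' (hecke q) (quotient_module N Nsub) \<and>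
      irreducible_module (hecke q) (quotient_module (quotient_module N Nsub) N'))
   \<and> (\<not> primitive_root_of_unity 3 (q ^ 2) \<longrightarrow>
      irreducible_module (hecke q) ((quotient_module N Nsub)\<lparr>carrier := N'\<rparr>))
   \<and> (primitive_root_of_unity 3 (q ^ 2) \<longrightarrow>
      submodule
        (weight_space q ((quotient_module N Nsub)\<lparr>carrier := N'\<rparr>) (weight_act (s1 \<circ> s2) t))
        (hecke q) ((quotient_module N Nsub)\<lparr>carrier := N'\<rparr>))"
proof -
  \<comment> \<open>\<open>N\<close> is treated as the module \<open>M\<close> for the parameter \<open>p\<close>\<close>
  define p where "p = - inverse q"
  have p2: "p ^ 2 = inverse (q ^ 2)" by (simp add: p_def power_inverse)
  interpret q: hecke_parameter q by (rule hecke_parameter.intro[OF q])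
  have "p \<noteq> 0" using q(1) by (simp add: p_def)
  moreover have "p ^ 2 \<noteq> 1" using q(2) by (simp only: p2 inverse_eq_1_iff not_False_eq_True)
  moreover have "p ^ 2 \<noteq> -1"
  proof
    assume "p ^ 2 = -1"
    then have "inverse (inverse (q ^ 2)) = inverse (-1)" by (simp add: p2)
    then show False using q(3) by simp
  qed
  ultimately interpret p: hecke_parameter p by (rule hecke_parameter.intro)
  interpret L: hecke_line q L vt
    by (intro hecke_line.intro hecke_line_axioms.intro q.hecke_parameter_axioms) (use L t in simp)
  have wt: "weight_act w0 t = weight_at 1 (p ^ 2)"
    unfolding w0 t weight_orbit by (simp add: fun_eq_iff weight_at_even powi_swap[of q, folded p_def])
  note swap = hecke_swap[of q, folded p_def] module_notions_swap[of q, folded p_def]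
  interpret L': hecke_line p L' vw0t
    by (intro hecke_line.intro hecke_line_axioms.intro p.hecke_parameter_axioms)
      (use L' in \<open>unfold wt swap p_def[symmetric]\<close>)
  note wtM = weight_orbit[of q, folded t]
  have wtN: "weight_act s2 t = wt6 p" "weight_act (s1 \<circ> s2) t = wt5 p"
    "weight_act (s2 \<circ> s1 \<circ> s2) t = wt4 p"
    unfolding wtM p_def weights_swap by (rule refl)+
  have prim: "primitive_root_of_unity 3 (p ^ 2) \<longleftrightarrow> primitive_root_of_unity 3 (q ^ 2)"
    by (simp add: primitive_root_of_unity_def p2 power_inverse)
  interpret M: coordinatised q L.M L.coordinates by (rule L.coordinatised_induced_module)
  interpret N: coordinatised p L'.M L'.coordinates by (rule L'.coordinatised_induced_module)
  have Msub': "Msub = weight_space q L.M (wt6 q)"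
    and M'': "M' = (\<lambda>x. Msub +>\<^bsub>L.M\<^esub> x) ` (weight_space q L.M (wt5 q) <+>\<^bsub>L.M\<^esub> weight_space q L.M (wt4 q))"
    unfolding Msub M' M wtM by (rule refl)+
  have N_eq: "N = L'.M" unfolding N swap ..
  have Nsub': "Nsub = weight_space p L'.M (wt6 p)"
    and N'': "N' = (\<lambda>x. Nsub +>\<^bsub>L'.M\<^esub> x) ` (weight_space p L'.M (wt5 p) <+>\<^bsub>L'.M\<^esub> weight_space p L'.M (wt4 p))"
    unfolding Nsub N' N_eq wtN swap by (rule refl)+
  show ?thesis
    using M.submodule_structure[folded Msub', folded M''] N.submodule_structure[folded Nsub', folded N'']
    unfolding prim wtN(2) wtM(3) N_eq M unfolding swap by blast
qed

end
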